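(* Let $n\ge 1$ be an integer, let $b>0$ be real and let $k\ge 2n$ be an integer. Then the homoclinic geodesic in $J^k(\mathbb{R},\mathbb{R})$ defined by the polynomial $F(x)=\pm(1-bx^{2n})$ (either sign) and the hill interval $\left[0,\sqrt[2n]{2/b}\right]$ is a metric line in $J^k(\mathbb{R},\mathbb{R})$.
   Context: **The sub-Riemannian manifold $J^k(\mathbb{R},\mathbb{R})$.** It is $\mathbb{R}^{k+2}$ with global coordinates $(x,\theta_0,\dots,\theta_k)$, with rank-2 distribution $\mathcal{D}$ given by $d\theta_i-\frac{1}{i!}x^i\,d\theta_0=0$, $i=1,\dots,k$, framed by the vector fields $X=\frac{\partial}{\partial x}$ and $Y=\sum_{i=0}^k\frac{x^i}{i!}\frac{\partial}{\partial\theta_i}$, which are declared orthonormal (the metric is $dx^2+d\theta_0^2$ restricted to $\mathcal{D}$). The sub-Riemannian distance between two points is the infimum of lengths of absolutely continuous curves tangent to $\mathcal{D}$ joining them. **Hill interval.** For a polynomial $F$, a closed interval $I$ is a hill interval of $F$ if $|F|<1$ in the interior of $I$ and $|F|=1$ on the boundary of $I$. **Geodesics.** Let $F$ be a polynomial of degree at most $k$ and $I$ a hill interval of $F$. A geodesic corresponding to the pair $(F,I)$ is a curve $\gamma:\mathbb{R}\to J^k(\mathbb{R},\mathbb{R})$ satisfying $\dot\gamma(t)=\dot x(t)X(\gamma(t))+F(x(t))Y(\gamma(t))$, where $(p_x(t),x(t))$, with $\dot x=p_x$ and $x(t)\in I$, is a solution of the one-degree-of-freedom Hamiltonian system $H_F=\frac12(p_x^2+F^2(x))$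 with energy $H_F=\frac12$. Such a curve is parametrized by arc length. **Homoclinic.** Let $F$ be non-constant and $I=[x_0,x_1]$. The geodesic is homoclinic if its reduced dynamics $(p_x(t),x(t))$ is a (non-constant) homoclinic orbit; this occurs exactly when one of $x_0,x_1$ is a regular point of $F$ and the other is a critical point of $F$. The homoclinic geodesic of a given pair $(F,I)$ is unique up to translation in time $t$ and translations in the coordinates $\theta_0,\dots,\theta_k$. **Metric line.** A geodesic $\gamma:\mathbb{R}\to M$ in a sub-Riemannian manifold $M$ is a metric line if $|a-b|=\mathrm{dist}_M(\gamma(a),\gamma(b))$ for every compact interval $[a,b]\subset\mathbb{R}$. *)

theory Defs
  imports "HOL-Analysis.Analysis" "HOL-Computational_Algebra.Polynomial"
begin

text \<open>
  A point or tangent vector of \<open>J\<^sup>k(\<real>,\<real>)\<close> is a pair \<open>(x, \<theta>)\<close>, where \<open>\<theta> i\<close> is the coordinate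
  \<open>\<theta>\<^sub>i\<close> for \<open>i \<le> k\<close>. The unused coordinates \<open>\<theta> i\<close>, \<open>i > k\<close>, are fixed to be \<open>0\<close>, so that
  equality of pairs is equality in \<open>\<real>\<^bsup>k+2\<^esup>\<close>.
\<close>

type_synonym jet = "real \<times> (nat \<Rightarrow> real)"

definition jet_space :: "nat \<Rightarrow> jet set" where
  "jet_space k = {q. \<forall>i>k. snd q i = 0}"

definition X_field :: "jet \<Rightarrow> jet" where
  "X_field q = (1, \<lambda>i. 0)"

definition Y_field :: "nat \<Rightarrow> jet \<Rightarrow> jet" where
  "Y_field k q = (0, \<lambda>i. if i \<le> k then fst q ^ i / fact i else 0)"

definition lin_comb :: "real \<Rightarrow> jet \<Rightarrow> real \<Rightarrow> jet \<Rightarrow> jet" where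
  "lin_comb u V v W = (u * fst V + v * fst W, \<lambda>i. u * snd V i + v * snd W i)"

definition has_velocity :: "nat \<Rightarrow> (real \<Rightarrow> jet) \<Rightarrow> jet \<Rightarrow> real \<Rightarrow> bool" where
  "has_velocity k c V t \<longleftrightarrow>
     ((\<lambda>s. fst (c s)) has_real_derivative fst V) (at t) \<and>
     (\<forall>i\<le>k. ((\<lambda>s. snd (c s) i) has_real_derivative snd V i) (at t))"

definition abs_continuous_on :: "real \<Rightarrow> real \<Rightarrow> (real \<Rightarrow> real) \<Rightarrow> bool" where
  "abs_continuous_on a b f \<longleftrightarrow>
     (\<forall>\<epsilon>>0. \<exists>\<delta>>0. \<forall>P :: (real \<times> real) set.
        finite P \<and> (\<forall>(u, v)\<in>P. a \<le> u \<and> u \<le> v \<and> v \<le> b) \<and>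
        disjoint_family_on (\<lambda>(u, v). {u<..<v}) P \<and>
        (\<Sum>(u, v)\<in>P. v - u) < \<delta> \<longrightarrow>
        (\<Sum>(u, v)\<in>P. \<bar>f v - f u\<bar>) < \<epsilon>)"

definition horizontal_curve :: "nat \<Rightarrow> real \<Rightarrow> real \<Rightarrow> (real \<Rightarrow> jet) \<Rightarrow> bool" where
  "horizontal_curve k a b c \<longleftrightarrow>
     (\<forall>t\<in>{a..b}. c t \<in> jet_space k) \<and>
     abs_continuous_on a b (\<lambda>t. fst (c t)) \<and>
     (\<forall>i\<le>k. abs_continuous_on a b (\<lambda>t. snd (c t) i)) \<and>
     (AE t in lebesgue. t \<in> {a..b} \<longrightarrow>
        (\<exists>u v. has_velocity k c (lin_comb u (X_field (c t)) v (Y_field k (c t))) t))"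

text \<open>
  Where the velocity is \<open>u X + v Y\<close>, one has \<open>u = dx/dt\<close> and \<open>v = d\<theta>\<^sub>0/dt\<close>, so the integrand is
  the norm of the velocity in the metric that makes \<open>X\<close> and \<open>Y\<close> orthonormal.
\<close>

definition sr_length :: "real \<Rightarrow> real \<Rightarrow> (real \<Rightarrow> jet) \<Rightarrow> ennreal" where
  "sr_length a b c =
     (\<integral>\<^sup>+t\<in>{a..b}. ennreal (sqrt ((deriv (\<lambda>s. fst (c s)) t)\<^sup>2 + (deriv (\<lambda>s. snd (c s) 0) t)\<^sup>2))
        \<partial>lebesgue)"

definition sr_dist :: "nat \<Rightarrow> jet \<Rightarrow> jet \<Rightarrow> ennreal" where
  "sr_dist k q q' =
     Inf {sr_length a b c | a b c. a \<le> b \<and> horizontal_curve k a b c \<and> c a = q \<and> c b = q'}"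

definition metric_line :: "nat \<Rightarrow> (real \<Rightarrow> jet) \<Rightarrow> bool" where
  "metric_line k \<gamma> \<longleftrightarrow> (\<forall>a b. a \<le> b \<longrightarrow> ennreal \<bar>a - b\<bar> = sr_dist k (\<gamma> a) (\<gamma> b))"

definition hill_interval :: "real poly \<Rightarrow> real set \<Rightarrow> bool" where
  "hill_interval F I \<longleftrightarrow>
     is_interval I \<and> closed I \<and> I \<noteq> {} \<and>
     (\<forall>x\<in>interior I. \<bar>poly F x\<bar> < 1) \<and> (\<forall>x\<in>frontier I. \<bar>poly F x\<bar> = 1)"

definition hamiltonian :: "real poly \<Rightarrow> real \<Rightarrow> real \<Rightarrow> real" where
  "hamiltonian F p x = (p\<^sup>2 + (poly F x)\<^sup>2) / 2"

definition hamiltonian_solution ::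
  "(real \<Rightarrow> real \<Rightarrow> real) \<Rightarrow> (real \<Rightarrow> real) \<Rightarrow> (real \<Rightarrow> real) \<Rightarrow> bool" where
  "hamiltonian_solution H p x \<longleftrightarrow>
     (\<forall>t. (x has_real_derivative deriv (\<lambda>q. H q (x t)) (p t)) (at t) \<and>
          (p has_real_derivative - deriv (\<lambda>y. H (p t) y) (x t)) (at t))"

definition homoclinic_orbit ::
  "(real \<Rightarrow> real \<Rightarrow> real) \<Rightarrow> (real \<Rightarrow> real) \<Rightarrow> (real \<Rightarrow> real) \<Rightarrow> bool" where
  "homoclinic_orbit H p x \<longleftrightarrow>
     hamiltonian_solution H p x \<and>
     \<not> (\<exists>p0 x0. \<forall>t. p t = p0 \<and> x t = x0) \<and>
     (\<exists>p0 x0. hamiltonian_solution H (\<lambda>_. p0) (\<lambda>_. x0) \<and>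
        ((\<lambda>t. (p t, x t)) \<longlongrightarrow> (p0, x0)) at_top \<and>
        ((\<lambda>t. (p t, x t)) \<longlongrightarrow> (p0, x0)) at_bot)"

definition jet_geodesic :: "nat \<Rightarrow> real poly \<Rightarrow> real set \<Rightarrow> (real \<Rightarrow> jet) \<Rightarrow> bool" where
  "jet_geodesic k F I \<gamma> \<longleftrightarrow>
     degree F \<le> k \<and> hill_interval F I \<and>
     (let x = (\<lambda>t. fst (\<gamma> t)); p = deriv x in
        hamiltonian_solution (hamiltonian F) p x \<and>
        (\<forall>t. hamiltonian F (p t) (x t) = 1 / 2) \<and>
        (\<forall>t. x t \<in> I) \<and>
        (\<forall>t. \<gamma> t \<in> jet_space k) \<and>
        (\<forall>t. has_velocity k \<gamma>
               (lin_comb (p t) (X_field (\<gamma> t)) (poly F (x t)) (Y_field k (\<gamma> t))) t))"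

definition homoclinic_geodesic :: "nat \<Rightarrow> real poly \<Rightarrow> real set \<Rightarrow> (real \<Rightarrow> jet) \<Rightarrow> bool" where
  "homoclinic_geodesic k F I \<gamma> \<longleftrightarrow>
     jet_geodesic k F I \<gamma> \<and> degree F > 0 \<and> (\<exists>x0 x1. x0 < x1 \<and> I = {x0..x1}) \<and>
     homoclinic_orbit (hamiltonian F) (deriv (\<lambda>t. fst (\<gamma> t))) (\<lambda>t. fst (\<gamma> t))"

end

theory Submission
  imports Defs
begin

text \<open>
  Put \<open>f(x) = 1 - b x\<^bsup>2n\<^esup>\<close> and \<open>R\<^sub>0 = (2/b)\<^bsup>1/2n\<^esup>\<close>. Of the constraints that the end points impose on a
  competing curve, the proof uses the increments of \<open>y = \<plusminus>\<theta>\<^sub>0\<close> and \<open>z = \<plusminus>(2n)! \<theta>\<^bsub>2n\<^esub>\<close>, which satisfy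
  \<open>dz = x\<^bsup>2n\<^esup> dy\<close> on horizontal curves; the sign is that of \<open>F = \<plusminus>f\<close>, so that \<open>dy = f dt\<close> on the
  geodesic.

  For each height \<open>R > 0\<close> let \<open>F\<^sub>R(x) = 1 - 2 (x/R)\<^bsup>2n\<^esup>\<close> and let \<open>S\<^sub>R\<close> be the even function with
  \<open>S\<^sub>R(0) = 0\<close> and \<open>S\<^sub>R'\<^sup>2 + F\<^sub>R\<^sup>2 = 1\<close> on \<open>[-R, R]\<close>. By the Cauchy-Schwarz inequality a curve in the
  strip \<open>\<bar>x\<bar> \<le> R\<close> has length at least \<open>\<plusminus>\<Delta>S\<^sub>R + \<Delta>y - (2/R\<^bsup>2n\<^esup>) \<Delta>z\<close>. The potential \<open>S\<close> at \<open>R = R\<^sub>0\<close>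
  gives equality for the geodesic on each of its two monotone halves, but it alone cannot show
  minimality: a competitor may leave the strip \<open>\<bar>x\<bar> \<le> R\<^sub>0\<close>, or turn around before reaching its
  boundary. The idea is to measure each competitor with the potential belonging to its own maximal
  height \<open>R\<close>. It goes up to \<open>\<bar>x\<bar> = R\<close> and down again, so its length is at least
  \<open>2 S\<^sub>R(R) - S\<^sub>R(x\<^sub>u) - S\<^sub>R(x\<^sub>v) + \<Delta>y - (2/R\<^bsup>2n\<^esup>) \<Delta>z\<close>, where \<open>x\<^sub>u\<close>, \<open>x\<^sub>v\<close> are the heights of its end
  points. This is the right estimate when the geodesic outside the given time interval stays below
  \<open>R\<close>; in the remaining case the geodesic is monotone on the interval and the competitor stays in
  \<open>\<bar>x\<bar> \<le> R\<^sub>0\<close>, so the potential of height \<open>R\<^sub>0\<close> suffices.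

  Now lengthen both curves by the same pieces of the geodesic, back to time \<open>-s\<close> and on to time
  \<open>s\<close>. As \<open>s\<close> grows the outer heights tend to \<open>0\<close>, and since \<open>S\<^sub>R(R) = \<kappa>R\<close> by homogeneity the bound
  becomes \<open>Y + 2\<kappa>R + 2A/R\<^bsup>2n\<^esup>\<close> with \<open>Y = \<Delta>y\<close> and \<open>A = -\<Delta>z\<close>. This is a convex function of \<open>R\<close>, equal
  in the limit to the duration of the geodesic at \<open>R = R\<^sub>0\<close>, and \<open>R\<^sub>0\<close> is its minimum. The last
  point is a virial identity: along the geodesic \<open>d(x dx/dt) = dt - dy + (2n+1) b dz\<close>, and the
  left side integrates to \<open>0\<close> over the whole homoclinic orbit. It turns the minimality of \<open>R\<^sub>0\<close>
  into \<open>2n r + r\<^bsup>-2n\<^esup> \<ge> 2n + 1\<close>, Bernoulli's inequality. The statements that carry this are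
  \<open>calibration_le_length\<close>, \<open>virial\<close>, \<open>travel_time_le_of_dominating\<close> and
  \<open>horizontal_curve_length_ge\<close>.

  The analytic input is that an absolutely continuous function is the integral of its almost
  everywhere derivative, \<open>has_integral_abs_continuous\<close>.
\<close>

section \<open>The fundamental theorem of calculus for absolutely continuous functions\<close>

definition subinterval_family :: "real \<Rightarrow> real \<Rightarrow> (real \<times> real) set \<Rightarrow> bool" where
  "subinterval_family a b P \<longleftrightarrow> finite P \<and> (\<forall>(u, v)\<in>P. a \<le> u \<and> u \<le> v \<and> v \<le> b) \<and>
     disjoint_family_on (\<lambda>(u, v). {u<..<v}) P"

lemma abs_continuous_on_alt:
  "abs_continuous_on a b f \<longleftrightarrow>
     (\<forall>\<epsilon>>0. \<exists>\<delta>>0. \<forall>P. subinterval_family a b P \<longrightarrow> (\<Sum>(u, v)\<in>P. v - u) < \<delta> \<longrightarrow>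
        (\<Sum>(u, v)\<in>P. \<bar>f v - f u\<bar>) < \<epsilon>)"
  unfolding abs_continuous_on_def subinterval_family_def by (simp only: conj_assoc imp_conjL)

lemma abs_continuous_onD:
  assumes "abs_continuous_on a b f" "\<epsilon> > 0"
  shows "\<exists>\<delta>>0. \<forall>P. subinterval_family a b P \<longrightarrow> (\<Sum>(u, v)\<in>P. v - u) < \<delta> \<longrightarrow>
        (\<Sum>(u, v)\<in>P. \<bar>f v - f u\<bar>) < \<epsilon>"
  using assms unfolding abs_continuous_on_alt by (elim allE[of _ \<epsilon>] impE)

lemma abs_continuous_on_lipschitz_bound:
  assumes f: "abs_continuous_on a b f" and "C \<ge> 0"
    and bd: "\<And>u v. u \<in> {a..b} \<Longrightarrow> v \<in> {a..b} \<Longrightarrow> \<bar>g v - g u\<bar> \<le> C * \<bar>f v - f u\<bar>"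
  shows "abs_continuous_on a b g"
  unfolding abs_continuous_on_alt
proof (intro allI impI)
  fix \<epsilon> :: real
  assume "\<epsilon> > 0"
  then have "\<epsilon> / (C + 1) > 0" using \<open>C \<ge> 0\<close> by simp
  obtain \<delta> where "\<delta> > 0" and \<delta>: "\<forall>P. subinterval_family a b P \<longrightarrow> (\<Sum>(u, v)\<in>P. v - u) < \<delta> \<longrightarrow>
        (\<Sum>(u, v)\<in>P. \<bar>f v - f u\<bar>) < \<epsilon> / (C + 1)"
    using abs_continuous_onD[OF f \<open>\<epsilon> / (C + 1) > 0\<close>] by blast
  show "\<exists>\<delta>>0. \<forall>P. subinterval_family a b P \<longrightarrow> (\<Sum>(u, v)\<in>P. v - u) < \<delta> \<longrightarrow>
        (\<Sum>(u, v)\<in>P. \<bar>g v - g u\<bar>) < \<epsilon>"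
  proof (intro exI[of _ \<delta>] conjI allI impI)
    fix P
    assume P: "subinterval_family a b P" "(\<Sum>(u, v)\<in>P. v - u) < \<delta>"
    then have le: "\<forall>(u, v)\<in>P. a \<le> u \<and> u \<le> v \<and> v \<le> b"
      unfolding subinterval_family_def by blast
    have "(\<Sum>(u, v)\<in>P. \<bar>g v - g u\<bar>) \<le> (\<Sum>(u, v)\<in>P. C * \<bar>f v - f u\<bar>)"
      using le by (intro sum_mono) (force intro!: bd)
    also have "\<dots> = C * (\<Sum>(u, v)\<in>P. \<bar>f v - f u\<bar>)"
      by (simp add: sum_distrib_left case_prod_unfold)
    also have "\<dots> \<le> C * (\<epsilon> / (C + 1))"
      using \<delta>[rule_format, OF P] \<open>C \<ge> 0\<close> by (intro mult_left_mono) auto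
    also have "\<dots> < \<epsilon>"
      using \<open>\<epsilon> > 0\<close> \<open>C \<ge> 0\<close> by (simp add: field_simps)
    finally show "(\<Sum>(u, v)\<in>P. \<bar>g v - g u\<bar>) < \<epsilon>" .
  qed (fact \<open>\<delta> > 0\<close>)
qed

lemma abs_continuous_on_ident: "abs_continuous_on a b (\<lambda>t. t)"
  unfolding abs_continuous_on_alt
proof (intro allI impI)
  fix \<epsilon> :: real
  assume "\<epsilon> > 0"
  have eq: "(\<Sum>(u, v)\<in>P. \<bar>v - u\<bar>) = (\<Sum>(u, v)\<in>P. v - u)" if "subinterval_family a b P" for P
  proof -
    have "\<forall>(u, v)\<in>P. u \<le> v"
      using that unfolding subinterval_family_def by blast
    then show ?thesis by (intro sum.cong) auto
  qed
  show "\<exists>\<delta>>0. \<forall>P. subinterval_family a b P \<longrightarrow> (\<Sum>(u, v)\<in>P. v - u) < \<delta> \<longrightarrow>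
        (\<Sum>(u, v)\<in>P. \<bar>v - u\<bar>) < \<epsilon>"
  proof (intro exI conjI allI impI)
    show "\<epsilon> > 0" by fact
    show "(\<Sum>(u, v)\<in>P. \<bar>v - u\<bar>) < \<epsilon>"
      if "subinterval_family a b P" "(\<Sum>(u, v)\<in>P. v - u) < \<epsilon>" for P
      unfolding eq[OF that(1)] by (fact that(2))
  qed
qed

lemma abs_continuous_on_bounded_derivative:
  assumes der: "\<And>t. (f has_real_derivative f' t) (at t)"
    and bd: "\<And>t. \<bar>f' t\<bar> \<le> C"
  shows "abs_continuous_on a b f"
proof (rule abs_continuous_on_lipschitz_bound[OF abs_continuous_on_ident])
  show "C \<ge> 0" using bd[of 0] by simp
  show "\<bar>f v - f u\<bar> \<le> C * \<bar>v - u\<bar>" for u v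
    using field_differentiable_bound[OF convex_UNIV, of f f' C v u] der bd by simp
qed

lemma abs_continuous_on_cmult:
  assumes "abs_continuous_on a b f"
  shows "abs_continuous_on a b (\<lambda>t. k * f t)"
  by (rule abs_continuous_on_lipschitz_bound[OF assms abs_ge_zero[of k]])
     (simp flip: abs_mult add: right_diff_distrib)

lemma abs_continuous_on_add:
  assumes f: "abs_continuous_on a b f" and g: "abs_continuous_on a b g"
  shows "abs_continuous_on a b (\<lambda>t. f t + g t)"
  unfolding abs_continuous_on_alt
proof (intro allI impI)
  fix \<epsilon> :: real
  assume "\<epsilon> > 0"
  then have "\<epsilon> / 2 > 0" by simp
  obtain \<delta> where "\<delta> > 0" and \<delta>: "\<forall>P. subinterval_family a b P \<longrightarrow> (\<Sum>(u, v)\<in>P. v - u) < \<delta> \<longrightarrow>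
        (\<Sum>(u, v)\<in>P. \<bar>f v - f u\<bar>) < \<epsilon> / 2"
    using abs_continuous_onD[OF f \<open>\<epsilon> / 2 > 0\<close>] by blast
  obtain \<eta> where "\<eta> > 0" and \<eta>: "\<forall>P. subinterval_family a b P \<longrightarrow> (\<Sum>(u, v)\<in>P. v - u) < \<eta> \<longrightarrow>
        (\<Sum>(u, v)\<in>P. \<bar>g v - g u\<bar>) < \<epsilon> / 2"
    using abs_continuous_onD[OF g \<open>\<epsilon> / 2 > 0\<close>] by blast
  show "\<exists>\<delta>>0. \<forall>P. subinterval_family a b P \<longrightarrow> (\<Sum>(u, v)\<in>P. v - u) < \<delta> \<longrightarrow>
        (\<Sum>(u, v)\<in>P. \<bar>f v + g v - (f u + g u)\<bar>) < \<epsilon>"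
  proof (intro exI[of _ "min \<delta> \<eta>"] conjI allI impI)
    fix P
    assume P: "subinterval_family a b P" "(\<Sum>(u, v)\<in>P. v - u) < min \<delta> \<eta>"
    have "(\<Sum>(u, v)\<in>P. \<bar>f v + g v - (f u + g u)\<bar>) \<le>
          (\<Sum>(u, v)\<in>P. \<bar>f v - f u\<bar>) + (\<Sum>(u, v)\<in>P. \<bar>g v - g u\<bar>)"
      unfolding sum.distrib[symmetric] by (intro sum_mono) auto
    also have "\<dots> < \<epsilon>" using \<delta>[rule_format, of P] \<eta>[rule_format, of P] P by auto
    finally show "(\<Sum>(u, v)\<in>P. \<bar>f v + g v - (f u + g u)\<bar>) < \<epsilon>" .
  qed (use \<open>\<delta> > 0\<close> \<open>\<eta> > 0\<close> in auto)
qed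

lemma abs_continuous_on_subinterval:
  assumes "abs_continuous_on a b f" "a \<le> a'" "b' \<le> b"
  shows "abs_continuous_on a' b' f"
  unfolding abs_continuous_on_alt
proof (intro allI impI)
  fix \<epsilon> :: real
  assume "\<epsilon> > 0"
  obtain \<delta> where "\<delta> > 0" and \<delta>: "\<forall>P. subinterval_family a b P \<longrightarrow> (\<Sum>(u, v)\<in>P. v - u) < \<delta> \<longrightarrow>
        (\<Sum>(u, v)\<in>P. \<bar>f v - f u\<bar>) < \<epsilon>"
    using abs_continuous_onD[OF assms(1) \<open>\<epsilon> > 0\<close>] by blast
  have sub: "subinterval_family a b P" if "subinterval_family a' b' P" for P
    using that assms(2,3) unfolding subinterval_family_def by fastforce
  show "\<exists>\<delta>>0. \<forall>P. subinterval_family a' b' P \<longrightarrow> (\<Sum>(u, v)\<in>P. v - u) < \<delta> \<longrightarrow>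
        (\<Sum>(u, v)\<in>P. \<bar>f v - f u\<bar>) < \<epsilon>"
    using \<open>\<delta> > 0\<close> \<delta> sub by blast
qed

lemma abs_continuous_on_imp_continuous_on:
  assumes "abs_continuous_on a b f"
  shows "continuous_on {a..b} f"
  unfolding continuous_on_iff
proof (intro ballI allI impI)
  fix s \<epsilon> :: real
  assume s: "s \<in> {a..b}" and "\<epsilon> > 0"
  obtain \<delta> where "\<delta> > 0" and \<delta>: "\<forall>P. subinterval_family a b P \<longrightarrow> (\<Sum>(u, v)\<in>P. v - u) < \<delta> \<longrightarrow>
        (\<Sum>(u, v)\<in>P. \<bar>f v - f u\<bar>) < \<epsilon>"
    using abs_continuous_onD[OF assms \<open>\<epsilon> > 0\<close>] by blast
  have "dist (f t) (f s) < \<epsilon>" if "t \<in> {a..b}" "dist t s < \<delta>" for t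
    using \<delta>[rule_format, of "{(s, t)}"] \<delta>[rule_format, of "{(t, s)}"] that s
    by (cases "s \<le> t")
       (auto simp: subinterval_family_def disjoint_family_on_def dist_real_def abs_minus_commute)
  with \<open>\<delta> > 0\<close> show "\<exists>d>0. \<forall>x'\<in>{a..b}. dist x' s < d \<longrightarrow> dist (f x') (f s) < \<epsilon>"
    by blast
qed

text \<open>
  The gauge integral makes this direct. At a tag where the derivative exists, a small interval
  contributes an error proportional to its length. The exceptional null set is covered by an open
  set of small measure, and the gauge forces every interval tagged there into that set; absolute
  continuity then bounds the total increment of \<open>f\<close> over these intervals.
\<close>

lemma has_integral_abs_continuous:
  assumes ac: "abs_continuous_on a b f" and "a \<le> b" and N: "negligible N"
    and der: "\<And>t. t \<in> {a..b} \<Longrightarrow> t \<notin> N \<Longrightarrow> (f has_real_derivative f' t) (at t)"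
  shows "(f' has_integral f b - f a) {a..b}"
proof -
  \<comment> \<open>The values on a null set do not affect the integral; the value 0 makes intervals tagged there contribute only an increment of \<open>f\<close>.\<close>
  define h where "h t = (if t \<in> N then 0 else f' t)" for t
  have "(h has_integral f b - f a) (cbox a b)"
    unfolding has_integral
  proof (intro allI impI)
    fix e :: real
    assume "e > 0"
    define e' where "e' = e / (2 * (b - a + 1))"
    have "e' > 0" using \<open>e > 0\<close> \<open>a \<le> b\<close> by (simp add: e'_def)
    have "\<exists>d>0. \<forall>y. \<bar>y - t\<bar> < d \<longrightarrow> \<bar>f y - f t - h t * (y - t)\<bar> \<le> e' * \<bar>y - t\<bar>"
      if "t \<in> {a..b} - N" for t
    proof -
      have "(f has_derivative (*) (f' t)) (at t)"
        using der that by (simp add: has_field_derivative_def)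
      then show ?thesis
        using \<open>e' > 0\<close> that by (auto simp: has_derivative_at_alt h_def)
    qed
    then obtain d where d: "\<And>t. t \<in> {a..b} - N \<Longrightarrow> d t > 0"
      "\<And>t y. t \<in> {a..b} - N \<Longrightarrow> \<bar>y - t\<bar> < d t \<Longrightarrow>
         \<bar>f y - f t - h t * (y - t)\<bar> \<le> e' * \<bar>y - t\<bar>"
      by metis
    have "e / 2 > 0" using \<open>e > 0\<close> by simp
    obtain \<delta> where "\<delta> > 0" and \<delta>: "\<forall>P. subinterval_family a b P \<longrightarrow> (\<Sum>(u, v)\<in>P. v - u) < \<delta> \<longrightarrow>
        (\<Sum>(u, v)\<in>P. \<bar>f v - f u\<bar>) < e / 2"
      using abs_continuous_onD[OF ac \<open>e / 2 > 0\<close>] by blast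
    obtain G where G: "open G" "N \<subseteq> G" "G \<in> lmeasurable" "measure lebesgue G < \<delta>"
    proof -
      have null: "N \<in> null_sets lebesgue" using N by (simp add: negligible_iff_null_sets)
      then have "N \<in> sets lebesgue" by blast
      then obtain G where G: "open G" "N \<subseteq> G" "G - N \<in> lmeasurable"
          "emeasure lebesgue (G - N) < ennreal \<delta>"
        using sets_lebesgue_outer_open \<open>\<delta> > 0\<close> by blast
      have "G \<in> sets lebesgue" using G(1) by (metis borel_open sets_completionI_sets sets_lborel)
      with G null have em: "emeasure lebesgue G < ennreal \<delta>"
        by (simp add: emeasure_Diff_null_set)
      moreover from em have "G \<in> lmeasurable"
        using \<open>G \<in> sets lebesgue\<close> by (intro fmeasurableI) (auto simp: less_top intro: order.strict_trans)
      moreover from this em have "measure lebesgue G < \<delta>"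
        by (simp add: emeasure_eq_measure2 ennreal_less_iff)
      ultimately show ?thesis using G that by blast
    qed
    define \<gamma> where "\<gamma> t = (if t \<in> N then G else if t \<in> {a..b} then ball t (d t) else UNIV)" for t
    show "\<exists>\<gamma>. gauge \<gamma> \<and> (\<forall>\<D>. \<D> tagged_division_of cbox a b \<and> \<gamma> fine \<D> \<longrightarrow>
            norm ((\<Sum>(x, k)\<in>\<D>. measure lborel k *\<^sub>R h x) - (f b - f a)) < e)"
    proof (intro exI conjI allI impI)
      show "gauge \<gamma>"
        using G d(1) by (auto simp: gauge_def \<gamma>_def)
    next
      fix p
      assume p: "p tagged_division_of cbox a b \<and> \<gamma> fine p"
      then have p1: "p tagged_division_of {a..b}" and fine: "\<gamma> fine p" by auto
      have "finite p" using p1 by blast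
      have K: "K = {Inf K..Sup K} \<and> Inf K \<le> t \<and> t \<le> Sup K \<and> a \<le> Inf K \<and> Sup K \<le> b
                \<and> measure lborel K = Sup K - Inf K \<and> K \<subseteq> \<gamma> t" if "(t, K) \<in> p" for t K
      proof -
        obtain u v where uv: "K = cbox u v" using p1 \<open>(t, K) \<in> p\<close> by blast
        moreover have "t \<in> K" "K \<subseteq> {a..b}"
          using p1 \<open>(t, K) \<in> p\<close> by (auto dest: tagged_division_ofD(2,3))
        ultimately show ?thesis
          using fine \<open>(t, K) \<in> p\<close> by (auto simp: fine_def)
      qed
      define D where "D = (\<lambda>(t, K). measure lborel K * h t - (f (Sup K) - f (Inf K)))"
      define pN where "pN = {(t, K) \<in> p. t \<in> N}"
      \<comment> \<open>Absolute continuity speaks of sets of pairs, so distinct tagged intervals must have distinct end points: degenerate intervals are dropped.\<close>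
      define q where "q = {(t, K) \<in> pN. Inf K < Sup K}"
      have sub: "pN \<subseteq> p" "q \<subseteq> pN" by (auto simp: pN_def q_def)
      have fin: "finite pN" "finite q" "finite (p - pN)"
        using \<open>finite p\<close> sub by (auto dest: finite_subset)
      have "(\<Sum>(x, k)\<in>p. measure lborel k *\<^sub>R h x) - (f b - f a) = sum D p"
        unfolding additive_tagged_division_1[OF \<open>a \<le> b\<close> p1, of f, symmetric] D_def
        by (simp add: sum_subtractf case_prod_unfold)
      also have "\<bar>\<dots>\<bar> \<le> (\<Sum>z\<in>p. \<bar>D z\<bar>)" by (rule sum_abs)
      also have "\<dots> = (\<Sum>z\<in>p - pN. \<bar>D z\<bar>) + (\<Sum>z\<in>pN. \<bar>D z\<bar>)"
        using sub \<open>finite p\<close> by (intro sum.subset_diff) auto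
      also have "(\<Sum>z\<in>p - pN. \<bar>D z\<bar>) \<le> e / 2"
      proof -
        have "(\<Sum>z\<in>p - pN. \<bar>D z\<bar>) \<le> (\<Sum>z\<in>p - pN. e' * (case z of (t, K) \<Rightarrow> measure lborel K))"
        proof (rule sum_mono)
          fix z assume "z \<in> p - pN"
          obtain t K where z: "z = (t, K)" by (cases z)
          have tK: "(t, K) \<in> p" and "t \<notin> N" using \<open>z \<in> p - pN\<close> by (auto simp: z pN_def)
          note K = K[OF tK]
          have t: "t \<in> {a..b} - N" using K \<open>t \<notin> N\<close> by auto
          have mem: "Inf K \<in> K" "Sup K \<in> K" using K by auto
          have "\<gamma> t = ball t (d t)" using t by (simp add: \<gamma>_def)
          with K have "K \<subseteq> ball t (d t)" by simp
          then have "\<bar>Inf K - t\<bar> < d t" "\<bar>Sup K - t\<bar> < d t"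
            using mem by (auto simp: dist_real_def)
          note close = this[THEN d(2)[OF t]]
          have len: "measure lborel K = Sup K - Inf K" using K by blast
          have "D z = (f (Inf K) - f t - h t * (Inf K - t)) - (f (Sup K) - f t - h t * (Sup K - t))"
            by (simp add: D_def z len algebra_simps)
          then have "\<bar>D z\<bar> \<le> e' * \<bar>Inf K - t\<bar> + e' * \<bar>Sup K - t\<bar>"
            using close by linarith
          also have "\<dots> = e' * (Sup K - Inf K)"
            using K by (simp add: algebra_simps)
          finally show "\<bar>D z\<bar> \<le> e' * (case z of (t, K) \<Rightarrow> measure lborel K)"
            by (simp add: z len)
        qed
        also have "\<dots> = e' * (\<Sum>z\<in>p - pN. (case z of (t, K) \<Rightarrow> measure lborel K))"
          by (simp add: sum_distrib_left)
        also have "\<dots> \<le> e' * (\<Sum>z\<in>p. (case z of (t, K) \<Rightarrow> measure lborel K))"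
          using \<open>e' > 0\<close> \<open>finite p\<close> by (intro mult_left_mono sum_mono2) auto
        also have "\<dots> = e' * (b - a)"
          using additive_content_tagged_division[of p a b] p \<open>a \<le> b\<close> by simp
        also have "\<dots> \<le> e / 2"
          using \<open>e > 0\<close> \<open>a \<le> b\<close> by (simp add: e'_def field_simps)
        finally show ?thesis .
      qed
      also have "(\<Sum>z\<in>pN. \<bar>D z\<bar>) < e / 2"
      proof -
        define ends where "ends = (\<lambda>(t :: real, K :: real set). (Inf K, Sup K))"
        have disj: "{Inf K<..<Sup K} \<inter> {Inf K'<..<Sup K'} = {}"
          if "(t, K) \<in> p" "(t', K') \<in> p" "(t, K) \<noteq> (t', K')" for t K t' K'
        proof -
          have "interior K \<inter> interior K' = {}"
            using p1 that by (blast dest: tagged_division_ofD(5))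
          then show ?thesis using K[OF that(1)] K[OF that(2)]
            by (metis interior_atLeastAtMost_real)
        qed
        have inj: "inj_on ends q"
        proof (rule inj_onI)
          fix z z' assume "z \<in> q" "z' \<in> q" "ends z = ends z'"
          then show "z = z'"
            using disj[of "fst z" "snd z" "fst z'" "snd z'"] sub
            by (auto simp: ends_def q_def pN_def split: prod.splits)
        qed
        have "(\<Sum>z\<in>pN. \<bar>D z\<bar>) = (\<Sum>z\<in>q. \<bar>D z\<bar>)"
        proof (rule sum.mono_neutral_right[OF fin(1) sub(2)], safe)
          fix t K assume "(t, K) \<in> pN" "(t, K) \<notin> q"
          then have "Inf K = Sup K" using K[of t K] sub by (auto simp: q_def)
          then show "\<bar>D (t, K)\<bar> = 0" using K[of t K] \<open>(t, K) \<in> pN\<close> sub by (auto simp: D_def)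
        qed
        also have "\<dots> = (\<Sum>z\<in>q. case ends z of (u, v) \<Rightarrow> \<bar>f v - f u\<bar>)"
          by (intro sum.cong) (auto simp: q_def pN_def D_def h_def ends_def)
        also have "\<dots> = (\<Sum>(u, v)\<in>ends ` q. \<bar>f v - f u\<bar>)"
          by (simp add: sum.reindex[OF inj])
        also have "\<dots> < e / 2"
        proof (rule \<delta>[rule_format])
          have fe: "finite (ends ` q)" using fin by simp
          have le: "\<forall>(u, v)\<in>ends ` q. a \<le> u \<and> u \<le> v \<and> v \<le> b"
          proof (rule ballI)
            fix w assume "w \<in> ends ` q"
            then obtain t K where "(t, K) \<in> q" and w: "w = (Inf K, Sup K)"
              by (auto simp: ends_def)
            then have "(t, K) \<in> p" using sub by blast
            from K[OF this] show "case w of (u, v) \<Rightarrow> a \<le> u \<and> u \<le> v \<and> v \<le> b"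
              unfolding w prod.case by linarith
          qed
          have dj: "disjoint_family_on (\<lambda>(u, v). {u<..<v}) (ends ` q)"
            unfolding disjoint_family_on_def
          proof (intro ballI impI)
            fix w w' assume ww: "w \<in> ends ` q" "w' \<in> ends ` q" "w \<noteq> w'"
            then obtain t K t' K' where q: "(t, K) \<in> q" "(t', K') \<in> q"
              and w: "w = (Inf K, Sup K)" "w' = (Inf K', Sup K')"
              by (auto simp: ends_def)
            then have "(t, K) \<in> p" "(t', K') \<in> p" using sub by blast+
            moreover have "(t, K) \<noteq> (t', K')" using ww(3) w by blast
            ultimately show "(case w of (u, v) \<Rightarrow> {u<..<v}) \<inter> (case w' of (u, v) \<Rightarrow> {u<..<v}) = {}"
              unfolding w prod.case by (rule disj)
          qed
          from fe le show "subinterval_family a b (ends ` q)"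
            unfolding subinterval_family_def using dj by blast
          have "(\<Sum>(u, v)\<in>ends ` q. v - u)
                  = (\<Sum>i\<in>ends ` q. measure lebesgue (case i of (u, v) \<Rightarrow> {u<..<v}))"
            using le by (intro sum.cong) auto
          also have "\<dots> = measure lebesgue (\<Union>i\<in>ends ` q. case i of (u, v) \<Rightarrow> {u<..<v})"
          proof (rule measure_finite_Union[symmetric, OF fe _ dj])
            show "emeasure lebesgue (case i of (u, v) \<Rightarrow> {u<..<v}) \<noteq> \<infinity>" if "i \<in> ends ` q" for i
              using bspec[OF le that] by (cases i) auto
          qed (auto split: prod.splits)
          also have "\<dots> \<le> measure lebesgue G"
          proof (rule measure_mono_fmeasurable)
            show "(\<Union>i\<in>ends ` q. case i of (u, v) \<Rightarrow> {u<..<v}) \<subseteq> G"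
            proof (rule subsetI)
              fix w assume "w \<in> (\<Union>i\<in>ends ` q. case i of (u, v) \<Rightarrow> {u<..<v})"
              then obtain t K where "(t, K) \<in> q" and w: "w \<in> {Inf K<..<Sup K}"
                by (auto simp: ends_def)
              then have "(t, K) \<in> p" "t \<in> N" by (auto simp: q_def pN_def)
              note K = K[OF this(1)]
              have "w \<in> {Inf K..Sup K}" using w by simp
              with K have "w \<in> \<gamma> t" by blast
              with \<open>t \<in> N\<close> show "w \<in> G" by (simp add: \<gamma>_def)
            qed
            show "(\<Union>i\<in>ends ` q. case i of (u, v) \<Rightarrow> {u<..<v}) \<in> sets lebesgue"
              by (intro sets.finite_UN fe) (auto split: prod.splits)
          qed (fact G)
          also have "\<dots> < \<delta>" by (rule G)
          finally show "(\<Sum>(u, v)\<in>ends ` q. v - u) < \<delta>" .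
        qed
        finally show ?thesis .
      qed
      finally show "norm ((\<Sum>(x, k)\<in>p. measure lborel k *\<^sub>R h x) - (f b - f a)) < e" by simp
    qed
  qed
  then have "(f' has_integral f b - f a) (cbox a b)"
    by (rule has_integral_spike[OF N, rotated]) (simp add: h_def)
  then show ?thesis by simp
qed

section \<open>Length of horizontal curves and calibrations\<close>

definition curve_speed :: "(real \<Rightarrow> jet) \<Rightarrow> real \<Rightarrow> real" where
  "curve_speed c t = sqrt ((deriv (\<lambda>s. fst (c s)) t)\<^sup>2 + (deriv (\<lambda>s. snd (c s) 0) t)\<^sup>2)"

text \<open>
  The equation \<open>d\<theta>\<^sub>i = (x\<^sup>i/i!) d\<theta>\<^sub>0\<close> of the distribution, with one exceptional null set for all
  coordinates.
\<close>

lemma horizontal_curve_derivatives: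
  assumes "horizontal_curve k a b c"
  obtains N where "negligible N"
    and "\<And>t. t \<in> {a..b} \<Longrightarrow> t \<notin> N \<Longrightarrow>
      ((\<lambda>s. fst (c s)) has_real_derivative deriv (\<lambda>s. fst (c s)) t) (at t)"
    and "\<And>t i. t \<in> {a..b} \<Longrightarrow> t \<notin> N \<Longrightarrow> i \<le> k \<Longrightarrow>
      ((\<lambda>s. snd (c s) i) has_real_derivative
         fst (c t) ^ i / fact i * deriv (\<lambda>s. snd (c s) 0) t) (at t)"
proof -
  have "AE t in lebesgue. t \<in> {a..b} \<longrightarrow>
      (\<exists>u v. has_velocity k c (lin_comb u (X_field (c t)) v (Y_field k (c t))) t)"
    using assms by (simp add: horizontal_curve_def)
  then obtain N where N: "N \<in> null_sets lebesgue"
    and bad: "{t. \<not> (t \<in> {a..b} \<longrightarrow>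
      (\<exists>u v. has_velocity k c (lin_comb u (X_field (c t)) v (Y_field k (c t))) t))} \<subseteq> N"
    by (auto simp: eventually_ae_filter)
  have vel: "\<exists>u v. ((\<lambda>s. fst (c s)) has_real_derivative u) (at t) \<and>
      (\<forall>i\<le>k. ((\<lambda>s. snd (c s) i) has_real_derivative fst (c t) ^ i / fact i * v) (at t))"
    if "t \<in> {a..b}" "t \<notin> N" for t
  proof -
    have "\<exists>u v. has_velocity k c (lin_comb u (X_field (c t)) v (Y_field k (c t))) t"
      using subsetD[OF bad, of t] that by auto
    then obtain u v where "has_velocity k c (lin_comb u (X_field (c t)) v (Y_field k (c t))) t"
      by (elim exE)
    then show ?thesis
      by (intro exI[of _ u] exI[of _ v])
         (simp add: has_velocity_def lin_comb_def X_field_def Y_field_def mult.commute)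
  qed
  show thesis
  proof
    show "negligible N" using N by (simp add: negligible_iff_null_sets)
    fix t
    assume t: "t \<in> {a..b}" "t \<notin> N"
    from vel[OF t] obtain u v where u: "((\<lambda>s. fst (c s)) has_real_derivative u) (at t)"
      and v: "\<And>i. i \<le> k \<Longrightarrow>
        ((\<lambda>s. snd (c s) i) has_real_derivative fst (c t) ^ i / fact i * v) (at t)"
      by blast
    from DERIV_imp_deriv[OF u] u
    show "((\<lambda>s. fst (c s)) has_real_derivative deriv (\<lambda>s. fst (c s)) t) (at t)" by simp
    from v[of 0] have "deriv (\<lambda>s. snd (c s) 0) t = v" by (simp add: DERIV_imp_deriv)
    then show "((\<lambda>s. snd (c s) i) has_real_derivative
         fst (c t) ^ i / fact i * deriv (\<lambda>s. snd (c s) 0) t) (at t)" if "i \<le> k" for i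
      using v[OF that] by simp
  qed
qed

text \<open>
  The derivatives of the coordinates are gauge integrable, hence Lebesgue measurable; a curve of
  finite length therefore has an integrable speed, and the length can be cut at intermediate times
  and compared with gauge integrals.
\<close>

lemma sr_length_eq_integral:
  assumes hor: "horizontal_curve k a b c" and "a \<le> b" and fin: "sr_length a b c < \<infinity>"
  shows "curve_speed c integrable_on {a..b}"
    and "sr_length a b c = ennreal (integral {a..b} (curve_speed c))"
proof -
  let ?L = "lebesgue_on {a..b}"
  obtain N where N: "negligible N"
    and x: "\<And>t. t \<in> {a..b} \<Longrightarrow> t \<notin> N \<Longrightarrow>
      ((\<lambda>s. fst (c s)) has_real_derivative deriv (\<lambda>s. fst (c s)) t) (at t)"
    and y: "\<And>t i. t \<in> {a..b} \<Longrightarrow> t \<notin> N \<Longrightarrow> i \<le> k \<Longrightarrow>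
      ((\<lambda>s. snd (c s) i) has_real_derivative
         fst (c t) ^ i / fact i * deriv (\<lambda>s. snd (c s) 0) t) (at t)"
    using horizontal_curve_derivatives[OF hor] by blast
  have ac: "abs_continuous_on a b (\<lambda>t. fst (c t))" "abs_continuous_on a b (\<lambda>t. snd (c t) 0)"
    using hor by (auto simp: horizontal_curve_def)
  have "deriv (\<lambda>s. fst (c s)) \<in> borel_measurable ?L"
    using has_integral_abs_continuous[OF ac(1) \<open>a \<le> b\<close> N x]
    by (intro integrable_imp_measurable) (auto simp: integrable_on_def)
  moreover have "deriv (\<lambda>s. snd (c s) 0) \<in> borel_measurable ?L"
    using has_integral_abs_continuous[OF ac(2) \<open>a \<le> b\<close> N, of "deriv (\<lambda>s. snd (c s) 0)"] y[of _ 0]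
    by (intro integrable_imp_measurable) (auto simp: integrable_on_def)
  ultimately have meas: "curve_speed c \<in> borel_measurable ?L"
    unfolding curve_speed_def by measurable
  have len: "sr_length a b c = (\<integral>\<^sup>+t. ennreal (curve_speed c t) \<partial>?L)"
    by (simp add: sr_length_def curve_speed_def nn_integral_restrict_space)
  have int: "integrable ?L (curve_speed c)"
    using fin unfolding len by (intro integrableI_nonneg meas) (auto simp: curve_speed_def)
  then show "curve_speed c integrable_on {a..b}"
    by (intro integrable_on_lebesgue_on) auto
  have "sr_length a b c = ennreal (integral\<^sup>L ?L (curve_speed c))"
    unfolding len by (intro nn_integral_eq_integral[OF int]) (simp add: curve_speed_def)
  then show "sr_length a b c = ennreal (integral {a..b} (curve_speed c))"
    using int by (simp add: lebesgue_integral_eq_integral)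
qed

lemma inner_le_norm_of_unit:
  fixes p q u v :: real
  assumes "p\<^sup>2 + q\<^sup>2 \<le> 1"
  shows "p * u + q * v \<le> sqrt (u\<^sup>2 + v\<^sup>2)"
proof (rule real_le_rsqrt)
  have "(p * u + q * v)\<^sup>2 + (p * v - q * u)\<^sup>2 = (p\<^sup>2 + q\<^sup>2) * (u\<^sup>2 + v\<^sup>2)"
    by (simp add: power2_eq_square algebra_simps)
  also have "\<dots> \<le> 1 * (u\<^sup>2 + v\<^sup>2)"
    using assms by (intro mult_right_mono) auto
  also have "\<dots> = u\<^sup>2 + v\<^sup>2" by simp
  finally show "(p * u + q * v)\<^sup>2 \<le> u\<^sup>2 + v\<^sup>2"
    using zero_le_power2[of "p * v - q * u"] by (meson add_increasing2 le_add_same_cancel1 order_trans)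
qed

text \<open>
  The function \<open>S(x) + \<alpha>\<theta>\<^sub>0 + \<beta>\<theta>\<^sub>m\<close> has horizontal gradient \<open>(S'(x), \<alpha> + \<beta>x\<^sup>m/m!)\<close>. Where this has
  norm at most 1, the function grows along a horizontal curve no faster than arc length. The bound
  \<open>C\<close> on \<open>S'\<close> makes \<open>S\<close> Lipschitz, so that \<open>S(x)\<close> stays absolutely continuous along the curve.
\<close>

lemma calibration_le_length:
  assumes hor: "horizontal_curve k a b c" and int: "curve_speed c integrable_on {a..b}"
    and uv: "a \<le> u" "u \<le> v" "v \<le> b" and "m \<le> k"
    and S: "\<And>s. (S has_real_derivative S' s) (at s)" "\<And>s. \<bar>S' s\<bar> \<le> C"
    and eikonal: "\<And>t. t \<in> {u..v} \<Longrightarrow>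
      (S' (fst (c t)))\<^sup>2 + (\<alpha> + \<beta> * fst (c t) ^ m / fact m)\<^sup>2 \<le> 1"
  shows "S (fst (c v)) - S (fst (c u)) + \<alpha> * (snd (c v) 0 - snd (c u) 0)
           + \<beta> * (snd (c v) m - snd (c u) m) \<le> integral {u..v} (curve_speed c)"
proof -
  obtain N where N: "negligible N"
    and x: "\<And>t. t \<in> {a..b} \<Longrightarrow> t \<notin> N \<Longrightarrow>
      ((\<lambda>s. fst (c s)) has_real_derivative deriv (\<lambda>s. fst (c s)) t) (at t)"
    and y: "\<And>t i. t \<in> {a..b} \<Longrightarrow> t \<notin> N \<Longrightarrow> i \<le> k \<Longrightarrow>
      ((\<lambda>s. snd (c s) i) has_real_derivative
         fst (c t) ^ i / fact i * deriv (\<lambda>s. snd (c s) 0) t) (at t)"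
    using horizontal_curve_derivatives[OF hor] by blast
  have ac: "abs_continuous_on u v (\<lambda>t. fst (c t))" "abs_continuous_on u v (\<lambda>t. snd (c t) 0)"
      "abs_continuous_on u v (\<lambda>t. snd (c t) m)"
    using hor \<open>m \<le> k\<close> uv
    by (auto simp: horizontal_curve_def intro: abs_continuous_on_subinterval[of a b])
  define g where "g t = S (fst (c t)) + (\<alpha> * snd (c t) 0 + \<beta> * snd (c t) m)" for t
  define g' where "g' t = S' (fst (c t)) * deriv (\<lambda>s. fst (c s)) t +
    (\<alpha> + \<beta> * fst (c t) ^ m / fact m) * deriv (\<lambda>s. snd (c s) 0) t" for t
  have "abs_continuous_on u v (\<lambda>t. S (fst (c t)))"
  proof (rule abs_continuous_on_lipschitz_bound[OF ac(1)])
    show "C \<ge> 0" using S(2)[of 0] by simp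
    show "\<bar>S (fst (c t)) - S (fst (c s))\<bar> \<le> C * \<bar>fst (c t) - fst (c s)\<bar>" for s t
      using field_differentiable_bound[OF convex_UNIV, of S S' C "fst (c t)" "fst (c s)"] S by simp
  qed
  then have "abs_continuous_on u v g"
    unfolding g_def using ac by (intro abs_continuous_on_add abs_continuous_on_cmult)
  moreover have "(g has_real_derivative g' t) (at t)" if t: "t \<in> {u..v}" "t \<notin> N" for t
  proof -
    have t': "t \<in> {a..b}" using t uv by auto
    show ?thesis
      unfolding g_def g'_def
      by (rule derivative_eq_intros DERIV_chain2[OF S(1)] x[OF t' t(2)]
            y[OF t' t(2) \<open>m \<le> k\<close>] y[OF t' t(2), of 0] refl | simp add: algebra_simps)+
  qed
  ultimately have "(g' has_integral g v - g u) {u..v}"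
    using has_integral_abs_continuous[OF _ \<open>u \<le> v\<close> N] by blast
  moreover have "(curve_speed c has_integral integral {u..v} (curve_speed c)) {u..v}"
    using integrable_on_subinterval[OF int, of u v] uv by (auto intro: integrable_integral)
  moreover have "g' t \<le> curve_speed c t" if "t \<in> {u..v}" for t
    using inner_le_norm_of_unit[OF eikonal[OF that]] by (simp add: g'_def curve_speed_def)
  ultimately have "g v - g u \<le> integral {u..v} (curve_speed c)"
    by (rule has_integral_le)
  then show ?thesis by (simp add: g_def algebra_simps)
qed

section \<open>The potential of a hill of given height\<close>

text \<open>
  The odd continuous square root of \<open>1 - (1 - 2s\<^bsup>2n\<^esup>)\<^sup>2 = 4s\<^bsup>2n\<^esup>(1 - s\<^bsup>2n\<^esup>)\<close> on \<open>[-1, 1]\<close>, extended by 0.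
  Oddness makes its primitive even, so that a curve may cross \<open>x = 0\<close> freely; the extension gives
  a primitive that is differentiable on the whole line, including the ends of the hill interval.
\<close>

definition hill_slope :: "nat \<Rightarrow> real \<Rightarrow> real" where
  "hill_slope n s = 2 * s * \<bar>s\<bar> ^ (n - 1) * sqrt (max 0 (1 - s ^ (2 * n)))"

lemma continuous_hill_slope: "isCont (hill_slope n) s"
  unfolding hill_slope_def by (intro continuous_intros)

lemma hill_slope_minus: "hill_slope n (- s) = - hill_slope n s"
  by (simp add: hill_slope_def)

lemma hill_slope_nonneg: "s \<ge> 0 \<Longrightarrow> hill_slope n s \<ge> 0"
  by (simp add: hill_slope_def)

lemma hill_slope_eikonal:
  assumes "n \<ge> 1" "\<bar>s\<bar> \<le> 1"
  shows "(hill_slope n s)\<^sup>2 + (1 - 2 * s ^ (2 * n))\<^sup>2 = 1"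
proof -
  have "s ^ (2 * n) \<le> 1"
    using assms(2) by (simp add: power_mult abs_square_le_1 power_le_one)
  have "(s * \<bar>s\<bar> ^ (n - 1))\<^sup>2 = s\<^sup>2 * (\<bar>s\<bar>\<^sup>2) ^ (n - 1)"
    by (simp only: power_mult_distrib power_mult[symmetric] mult.commute)
  also have "\<dots> = (s\<^sup>2) ^ Suc (n - 1)" by simp
  also have "\<dots> = s ^ (2 * n)" using assms(1) by (simp add: power_mult)
  finally have "(s * \<bar>s\<bar> ^ (n - 1))\<^sup>2 = s ^ (2 * n)" .
  moreover have "(hill_slope n s)\<^sup>2 = 4 * (s * \<bar>s\<bar> ^ (n - 1))\<^sup>2 * (sqrt (max 0 (1 - s ^ (2 * n))))\<^sup>2"
    by (simp only: hill_slope_def power_mult_distrib) simp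
  ultimately have "(hill_slope n s)\<^sup>2 = 4 * s ^ (2 * n) * (1 - s ^ (2 * n))"
    using \<open>s ^ (2 * n) \<le> 1\<close> by simp
  then show ?thesis by (simp add: power2_eq_square algebra_simps)
qed

lemma abs_hill_slope_le_1:
  assumes "n \<ge> 1"
  shows "\<bar>hill_slope n s\<bar> \<le> 1"
proof (cases "\<bar>s\<bar> \<le> 1")
  case True
  then have "(hill_slope n s)\<^sup>2 \<le> 1"
    using hill_slope_eikonal[OF assms True] zero_le_power2[of "1 - 2 * s ^ (2 * n)"] by linarith
  then show ?thesis by (simp add: abs_square_le_1)
next
  case False
  then have "1 \<le> \<bar>s\<bar> ^ (2 * n)" by (intro one_le_power) simp
  then have "1 \<le> s ^ (2 * n)" by (simp add: power_even_abs)
  then show ?thesis by (simp add: hill_slope_def)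
qed

lemma ex_hill_action:
  "\<exists>g. (\<forall>s. (g has_real_derivative hill_slope n s) (at s)) \<and> g 0 = 0 \<and> (\<forall>s. g (- s) = g s)"
proof -
  obtain f where "\<And>s. (f has_vector_derivative hill_slope n s) (at s)"
    using einterval_antiderivative[of "-\<infinity>" \<infinity> "hill_slope n"] continuous_hill_slope by auto
  then have f: "(f has_real_derivative hill_slope n s) (at s)" for s
    by (simp add: has_real_derivative_iff_has_vector_derivative)
  have "((\<lambda>s. f (- s) - f s) has_real_derivative 0) (at s)" for s
  proof -
    have "((\<lambda>s. f (- s)) has_real_derivative hill_slope n (- s) * (- 1)) (at s)"
      by (rule DERIV_chain2[OF f]) (auto intro!: derivative_eq_intros)
    from DERIV_diff[OF this f] show ?thesis by (simp add: hill_slope_minus)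
  qed
  then have "f (- s) - f s = f (- 0) - f 0" for s
    by (rule DERIV_isconst_all[rule_format, of "\<lambda>s. f (- s) - f s" s 0])
  then show ?thesis
    using f by (intro exI[of _ "\<lambda>s. f s - f 0"]) (auto intro!: derivative_eq_intros)
qed

definition hill_action :: "nat \<Rightarrow> real \<Rightarrow> real" where
  "hill_action n = (SOME g. (\<forall>s. (g has_real_derivative hill_slope n s) (at s)) \<and>
     g 0 = 0 \<and> (\<forall>s. g (- s) = g s))"

lemma hill_action:
  "(hill_action n has_real_derivative hill_slope n s) (at s)"
  "hill_action n 0 = 0" "hill_action n (- s) = hill_action n s"
  using someI_ex[OF ex_hill_action[of n]] by (auto simp: hill_action_def)

text \<open>
  The potential \<open>S\<^sub>R\<close>. Defining it by scaling makes \<open>S\<^sub>R(R)\<close> proportional to \<open>R\<close>.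
\<close>

definition hill_potential :: "nat \<Rightarrow> real \<Rightarrow> real \<Rightarrow> real" where
  "hill_potential n R x = R * hill_action n (x / R)"

lemma hill_potential_derivative:
  assumes "R > 0"
  shows "(hill_potential n R has_real_derivative hill_slope n (x / R)) (at x)"
proof -
  have "((\<lambda>x. hill_action n (x / R)) has_real_derivative hill_slope n (x / R) * (1 / R)) (at x)"
    by (rule DERIV_chain2[OF hill_action(1) DERIV_cdivide[OF DERIV_ident]])
  from DERIV_cmult[OF this, of R]
  have "((\<lambda>x. R * hill_action n (x / R)) has_real_derivative R * (hill_slope n (x / R) * (1 / R))) (at x)" .
  moreover have "R * (hill_slope n (x / R) * (1 / R)) = hill_slope n (x / R)"
    using assms by simp
  ultimately show ?thesis
    by (simp only: hill_potential_def[abs_def])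
qed

lemma hill_potential_abs: "hill_potential n R \<bar>x\<bar> = hill_potential n R x"
  by (cases "x \<ge> 0") (auto simp: hill_potential_def hill_action(3))

text \<open>
  The eikonal equation for the polynomial \<open>1 - 2(x/R)\<^bsup>2n\<^esup>\<close>, whose hill interval is \<open>[0, R]\<close>.
\<close>

lemma hill_potential_eikonal:
  assumes "n \<ge> 1" "R > 0" "\<bar>x\<bar> \<le> R"
  shows "(hill_slope n (x / R))\<^sup>2 + (1 - 2 / R ^ (2 * n) * x ^ (2 * n))\<^sup>2 = 1"
  using hill_slope_eikonal[of n "x / R"] assms by (simp add: power_divide)

lemma hill_potential_nonneg:
  assumes "R > 0" "x \<ge> 0"
  shows "hill_potential n R x \<ge> 0"
proof -
  have "hill_potential n R 0 \<le> hill_potential n R x"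
  proof (rule DERIV_nonneg_imp_nondecreasing[OF assms(2)])
    fix s :: real assume "0 \<le> s"
    then have "hill_slope n (s / R) \<ge> 0"
      using assms(1) by (intro hill_slope_nonneg) simp
    with hill_potential_derivative[OF \<open>R > 0\<close>]
    show "\<exists>D. (hill_potential n R has_real_derivative D) (at s) \<and> 0 \<le> D" by blast
  qed
  then show ?thesis by (simp add: hill_potential_def hill_action(2))
qed

lemma hill_potential_tendsto_0:
  assumes "R > 0" "(x \<longlongrightarrow> 0) G"
  shows "((\<lambda>t. hill_potential n R (x t)) \<longlongrightarrow> 0) G"
proof -
  have "isCont (hill_potential n R) 0"
    using hill_potential_derivative[OF \<open>R > 0\<close>] by (rule DERIV_isCont)
  from isCont_tendsto_compose[OF this assms(2)] show ?thesis
    by (simp add: hill_potential_def hill_action(2))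
qed

text \<open>
  Up to a nonnegative factor and an additive constant, the left side with \<open>r = R/R\<^sub>0\<close> is the
  calibration bound for a curve of height \<open>R\<close>; the claim is that \<open>r = 1\<close> minimizes it. After
  multiplication by \<open>1/r\<close> this is Bernoulli's inequality for \<open>1/r\<close>.
\<close>

lemma mean_inequality_scaling:
  fixes r :: real
  assumes "r > 0"
  shows "2 * real n * r + 1 / r ^ (2 * n) \<ge> 2 * real n + 1"
proof -
  have "1 + real (2 * n + 1) * (1 / r - 1) \<le> (1 + (1 / r - 1)) ^ (2 * n + 1)"
    using assms by (intro Bernoulli_inequality) simp
  then have "r * (1 + real (2 * n + 1) * (1 / r - 1)) \<le> r * (1 / r) ^ (2 * n + 1)"
    using assms by (intro mult_left_mono) auto
  also have "r * (1 / r) ^ (2 * n + 1) = 1 / r ^ (2 * n)"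
    using assms by (simp add: power_one_over)
  finally have "r * (1 + real (2 * n + 1) * (1 / r - 1)) \<le> 1 / r ^ (2 * n)" .
  moreover have "r * (1 + real (2 * n + 1) * (1 / r - 1)) = 2 * real n + 1 - 2 * real n * r"
    using assms by (simp add: field_simps)
  ultimately show ?thesis by linarith
qed

section \<open>The homoclinic motion\<close>

text \<open>
  The homoclinic motion in the variables in which the sign of \<open>F\<close> and the factorials have
  disappeared.
\<close>

locale homoclinic_motion =
  fixes n :: nat and b R0 :: real and x p y z :: "real \<Rightarrow> real"
  assumes n: "n \<ge> 1" and R0: "R0 > 0" and b: "b = 2 / R0 ^ (2 * n)"
    and x_deriv: "(x has_real_derivative p t) (at t)"
    and p_deriv: "(p has_real_derivative
      2 * real n * b * x t ^ (2 * n - 1) * (1 - b * x t ^ (2 * n))) (at t)"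
    and y_deriv: "(y has_real_derivative 1 - b * x t ^ (2 * n)) (at t)"
    and z_deriv: "(z has_real_derivative x t ^ (2 * n) * (1 - b * x t ^ (2 * n))) (at t)"
    and energy: "(p t)\<^sup>2 + (1 - b * x t ^ (2 * n))\<^sup>2 = 1"
    and x_nonneg: "0 \<le> x t" and x_le: "x t \<le> R0"
    and nontrivial: "\<exists>t. x t \<noteq> 0"
    and x_top: "(x \<longlongrightarrow> 0) at_top" and x_bot: "(x \<longlongrightarrow> 0) at_bot"
begin

lemma b_pos: "b > 0"
  using R0 by (simp add: b)

lemma abs_p_le_1: "\<bar>p t\<bar> \<le> 1"
proof -
  have "(p t)\<^sup>2 \<le> 1"
    using energy[of t] zero_le_power2[of "1 - b * x t ^ (2 * n)"] by linarith
  then show ?thesis by (simp add: abs_square_le_1)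
qed

lemma slope_eq_abs_p: "hill_slope n (x t / R0) = \<bar>p t\<bar>"
proof -
  have "(hill_slope n (x t / R0))\<^sup>2 = (p t)\<^sup>2"
    using hill_potential_eikonal[OF n R0, of "x t"] energy[of t] x_nonneg[of t] x_le[of t]
    by (simp add: b)
  moreover have "hill_slope n (x t / R0) \<ge> 0"
    using x_nonneg R0 by (intro hill_slope_nonneg) simp
  ultimately show ?thesis by (metis abs_of_nonneg power2_eq_iff abs_minus_cancel)
qed

text \<open>
  The speed vanishes at least linearly at the equilibrium \<open>x = 0\<close>, so the equilibrium cannot be
  reached in finite time.
\<close>

lemma abs_p_le_x: "\<bar>p t\<bar> \<le> 2 / R0 * x t"
proof -
  define s where "s = x t / R0"
  have s: "0 \<le> s" "s \<le> 1" using x_nonneg x_le R0 by (auto simp: s_def)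
  have "\<bar>p t\<bar> = hill_slope n s" by (simp add: s_def slope_eq_abs_p)
  also have "\<dots> = 2 * s * (s ^ (n - 1) * sqrt (max 0 (1 - s ^ (2 * n))))"
    using s by (simp add: hill_slope_def)
  also have "\<dots> \<le> 2 * s * (1 * 1)"
    using s by (intro mult_left_mono mult_mono) (auto simp: power_le_one)
  finally show ?thesis by (simp add: s_def)
qed

text \<open>
  Since \<open>\<bar>dx/dt\<bar> \<le> Cx\<close>, the products of \<open>x\<close> with \<open>e\<^bsup>Ct\<^esup>\<close> and \<open>e\<^bsup>-Ct\<^esup>\<close> are monotone; one zero would
  make the motion constant.
\<close>

lemma x_pos: "x t > 0"
proof (rule ccontr)
  assume "\<not> x t > 0"
  then have "x t = 0" using x_nonneg[of t] by simp
  define C where "C = 2 / R0"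
  have p: "\<bar>p s\<bar> \<le> C * x s" for s using abs_p_le_x by (simp add: C_def)
  have "x s = 0" for s
  proof (cases "s \<le> t")
    case True
    have "x s * exp (C * s) \<le> x t * exp (C * t)"
    proof (rule DERIV_nonneg_imp_nondecreasing[OF True])
      fix u
      have "((\<lambda>s. x s * exp (C * s)) has_real_derivative (p u + C * x u) * exp (C * u)) (at u)"
        by (auto intro!: derivative_eq_intros x_deriv simp: algebra_simps)
      moreover have "(p u + C * x u) * exp (C * u) \<ge> 0"
        using p[of u] by (intro mult_nonneg_nonneg) auto
      ultimately show "\<exists>D. ((\<lambda>s. x s * exp (C * s)) has_real_derivative D) (at u) \<and> 0 \<le> D"
        by blast
    qed
    then show ?thesis using \<open>x t = 0\<close> x_nonneg[of s] by (simp add: mult_le_0_iff)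
  next
    case False
    have "x s * exp (- C * s) \<le> x t * exp (- C * t)"
    proof (rule DERIV_nonpos_imp_nonincreasing[of t s])
      fix u
      have "((\<lambda>s. x s * exp (- C * s)) has_real_derivative (p u - C * x u) * exp (- C * u)) (at u)"
        by (auto intro!: derivative_eq_intros x_deriv simp: algebra_simps)
      moreover have "(p u - C * x u) * exp (- C * u) \<le> 0"
        using p[of u] by (intro mult_nonpos_nonneg) auto
      ultimately show "\<exists>D. ((\<lambda>s. x s * exp (- C * s)) has_real_derivative D) (at u) \<and> D \<le> 0"
        by blast
    qed (use False in simp)
    then show ?thesis using \<open>x t = 0\<close> x_nonneg[of s] by (simp add: mult_le_0_iff)
  qed
  with nontrivial show False by simp
qed

text \<open>
  By energy conservation \<open>x\<close> can only turn at an end of the hill interval, and the equilibrium end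
  is excluded by positivity. At the other end the force points back.
\<close>

lemma turning:
  assumes "p t = 0"
  shows "x t = R0" and "2 * real n * b * x t ^ (2 * n - 1) * (1 - b * x t ^ (2 * n)) < 0"
proof -
  have "(1 - b * x t ^ (2 * n))\<^sup>2 = 1" using energy[of t] assms by simp
  moreover have "b * x t ^ (2 * n) > 0" using b_pos x_pos by simp
  ultimately have eq: "b * x t ^ (2 * n) = 2"
    unfolding power2_eq_1_iff by linarith
  then have "x t ^ (2 * n) = R0 ^ (2 * n)"
    using R0 by (simp add: b field_simps)
  moreover have "0 \<le> R0" "0 < 2 * n" using R0 n by simp_all
  ultimately show "x t = R0"
    using power_eq_imp_eq_base[of "x t" "2 * n" R0] x_nonneg[of t] by blast
  show "2 * real n * b * x t ^ (2 * n - 1) * (1 - b * x t ^ (2 * n)) < 0"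
    unfolding eq using n b_pos x_pos[of t] by simp
qed

lemma p_cont: "continuous_on A p"
  using p_deriv by (meson DERIV_isCont continuous_at_imp_continuous_on)

text \<open>
  Every zero of \<open>p\<close> is a strict down-crossing, so there is no first zero after a time at which \<open>p\<close>
  is negative.
\<close>

lemma p_stays_negative:
  assumes "p s < 0" "s < t"
  shows "p t < 0"
proof (rule ccontr)
  assume "\<not> p t < 0"
  define Z where "Z = {u \<in> {s..t}. p u = 0}"
  have "\<exists>u\<ge>s. u \<le> t \<and> p u = 0"
    using assms \<open>\<not> p t < 0\<close> by (intro IVT') (auto intro: p_cont)
  then have "Z \<noteq> {}" by (auto simp: Z_def)
  moreover have "closed Z"
    unfolding Z_def using p_cont by (intro continuous_closed_preimage_constant) auto
  moreover have "bdd_below Z" by (auto simp: Z_def)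
  ultimately have "Inf Z \<in> Z" by (intro closed_contains_Inf)
  define u where "u = Inf Z"
  have u: "p u = 0" "s \<le> u" "u \<le> t" using \<open>Inf Z \<in> Z\<close> by (auto simp: u_def Z_def)
  with assms have "s < u" by (cases "s = u") auto
  obtain d where d: "d > 0" "\<And>h. 0 < h \<Longrightarrow> h < d \<Longrightarrow> p u < p (u - h)"
    using DERIV_neg_dec_left[OF p_deriv turning(2)[OF u(1)]] by blast
  define h where "h = min (d / 2) (u - s)"
  have h: "0 < h" "h < d" "s \<le> u - h" using d \<open>s < u\<close> by (auto simp: h_def min_def)
  have "p (u - h) > 0" using d(2)[OF h(1,2)] u by simp
  then have "\<exists>w\<ge>s. w \<le> u - h \<and> p w = 0"
    using assms h by (intro IVT') (auto intro: p_cont)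
  then obtain w where w: "s \<le> w" "w \<le> u - h" "p w = 0" by blast
  then have "w \<in> Z" using h u by (auto simp: Z_def)
  then have "u \<le> w" unfolding u_def using \<open>bdd_below Z\<close> by (rule cInf_lower)
  with w h show False by simp
qed

lemma p_negative_after_zero:
  assumes "p s = 0" "s < t"
  shows "p t < 0"
proof -
  obtain d where d: "d > 0" "\<And>h. 0 < h \<Longrightarrow> h < d \<Longrightarrow> p (s + h) < p s"
    using DERIV_neg_dec_right[OF p_deriv turning(2)[OF assms(1)]] by blast
  define h where "h = min d (t - s) / 2"
  have h: "0 < h" "h < d" "s + h < t" using d assms by (auto simp: h_def min_def field_simps)
  with d assms have "p (s + h) < 0" by fastforce
  from p_stays_negative[OF this h(3)] show ?thesis .
qed

text \<open>
  The motion rises from 0 and falls back to 0, so \<open>p\<close> takes both signs; its zero is unique because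
  \<open>p\<close> can only change from positive to negative.
\<close>

lemma turning_time:
  obtains T where "x T = R0" "\<And>t. t < T \<Longrightarrow> p t > 0" "\<And>t. T < t \<Longrightarrow> p t < 0"
proof -
  have "eventually (\<lambda>t. x t < x 0) at_bot" "eventually (\<lambda>t. x t < x 0) at_top"
    using order_tendstoD(2)[OF x_bot x_pos] order_tendstoD(2)[OF x_top x_pos] by auto
  then obtain A B where "\<forall>t\<le>A. x t < x 0" "\<forall>t\<ge>B. x t < x 0"
    unfolding eventually_at_bot_linorder eventually_at_top_linorder by blast
  then have AB: "x (min A (- 1)) < x 0" "x (max B 1) < x 0" by simp_all
  have "\<exists>s>min A (- 1). s < 0 \<and> x 0 - x (min A (- 1)) = (0 - min A (- 1)) * p s"
    by (rule MVT2[OF _ x_deriv]) simp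
  then obtain s where s: "s < 0" "x 0 - x (min A (- 1)) = (0 - min A (- 1)) * p s" by blast
  have "0 < (0 - min A (- 1)) * p s" using s(2) AB by simp
  then have "p s > 0" by (rule zero_less_mult_pos) simp
  have "\<exists>s'>0. s' < max B 1 \<and> x (max B 1) - x 0 = (max B 1 - 0) * p s'"
    by (rule MVT2[OF _ x_deriv]) simp
  then obtain s' where s': "0 < s'" "x (max B 1) - x 0 = (max B 1 - 0) * p s'" by blast
  have "0 < (max B 1 - 0) * (- p s')" using s'(2) AB by simp
  then have "- p s' > 0" by (rule zero_less_mult_pos) simp
  then have "p s' < 0" by simp
  have "\<exists>T\<ge>s. T \<le> s' \<and> p T = 0"
    using \<open>p s > 0\<close> \<open>p s' < 0\<close> s s' by (intro IVT2') (auto intro: p_cont)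
  then obtain T where T: "p T = 0" by blast
  show ?thesis
  proof
    show "x T = R0" by (rule turning(1)[OF T])
    show "p t < 0" if "T < t" for t using p_negative_after_zero[OF T that] .
    show "p t > 0" if "t < T" for t
      using p_stays_negative[of t T] p_negative_after_zero[of t T] that T by fastforce
  qed
qed

text \<open>
  The derivative of \<open>x p\<close> is \<open>p\<^sup>2 - x f f'\<close>, and \<open>x f' = -2n b x\<^bsup>2n\<^esup>\<close> because the non-constant part
  of \<open>f\<close> is homogeneous. With \<open>p\<^sup>2 = 1 - f\<^sup>2\<close> every term is an increment of \<open>t\<close>, \<open>y\<close> or \<open>z\<close>.
\<close>

lemma virial:
  "t - s - (y t - y s) + (2 * real n + 1) * b * (z t - z s) = x t * p t - x s * p s"
proof -
  define g where "g t = x t * p t - (t - y t + (2 * real n + 1) * b * z t)" for t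
  have "(g has_real_derivative 0) (at u)" for u
  proof -
    let ?w = "x u ^ (2 * n)"
    have w: "x u ^ (2 * n - 1) * x u = ?w"
      using n by (simp flip: power_Suc2)
    have "(g has_real_derivative p u * p u + (2 * real n * b * x u ^ (2 * n - 1) * (1 - b * ?w)) * x u
        - (1 - (1 - b * ?w) + (2 * real n + 1) * b * (?w * (1 - b * ?w)))) (at u)"
      unfolding g_def
      by (auto intro!: derivative_eq_intros x_deriv p_deriv y_deriv z_deriv)
    also have "p u * p u = 1 - (1 - b * ?w)\<^sup>2"
      using energy[of u] by (simp add: power2_eq_square)
    also have "(2 * real n * b * x u ^ (2 * n - 1) * (1 - b * ?w)) * x u = 2 * real n * b * ?w * (1 - b * ?w)"
      unfolding w[symmetric] by (simp only: ac_simps)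
    also have "1 - (1 - b * ?w)\<^sup>2 + 2 * real n * b * ?w * (1 - b * ?w)
        - (1 - (1 - b * ?w) + (2 * real n + 1) * b * (?w * (1 - b * ?w))) = 0"
      by (simp add: power2_eq_square algebra_simps)
    finally show ?thesis .
  qed
  then have "g t = g s" by (intro DERIV_isconst_all[rule_format])
  then show ?thesis by (simp add: g_def algebra_simps)
qed

text \<open>
  Both sides increase at rate \<open>p\<^sup>2\<close>: the left one since \<open>1 - f + b x\<^bsup>2n\<^esup> f = 1 - f\<^sup>2\<close>, the right one
  since the slope of the potential is \<open>\<bar>p\<bar>\<close>. This is equality in the calibration estimate at the
  height \<open>R\<^sub>0\<close>.
\<close>

lemma action_rising:
  assumes "u \<le> v" "\<And>t. u < t \<Longrightarrow> t < v \<Longrightarrow> p t \<ge> 0"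
  shows "v - u - (y v - y u) + b * (z v - z u) = hill_potential n R0 (x v) - hill_potential n R0 (x u)"
proof (cases "u = v")
  case False
  define g where "g t = hill_potential n R0 (x t) - (t - y t + b * z t)" for t
  have der: "(g has_real_derivative hill_slope n (x t / R0) * p t - (1 - (1 - b * x t ^ (2 * n))
      + b * (x t ^ (2 * n) * (1 - b * x t ^ (2 * n))))) (at t)" for t
    unfolding g_def
    by (auto intro!: derivative_eq_intros DERIV_chain2[OF hill_potential_derivative[OF R0]]
        x_deriv y_deriv z_deriv)
  have "(g has_real_derivative 0) (at t)" if "u < t" "t < v" for t
    using der[of t] energy[of t] assms(2)[OF that]
    by (simp add: slope_eq_abs_p power2_eq_square algebra_simps)
  moreover have "continuous_on {u..v} g"
    by (intro continuous_at_imp_continuous_on ballI DERIV_isCont[OF der])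
  ultimately have "g v = g u"
    using assms(1) False DERIV_isconst_end[of u v g] by simp
  then show ?thesis by (simp add: g_def algebra_simps)
qed simp

lemma action_falling:
  assumes "u \<le> v" "\<And>t. u < t \<Longrightarrow> t < v \<Longrightarrow> p t \<le> 0"
  shows "v - u - (y v - y u) + b * (z v - z u) = hill_potential n R0 (x u) - hill_potential n R0 (x v)"
proof (cases "u = v")
  case False
  define g where "g t = hill_potential n R0 (x t) + (t - y t + b * z t)" for t
  have der: "(g has_real_derivative hill_slope n (x t / R0) * p t + (1 - (1 - b * x t ^ (2 * n))
      + b * (x t ^ (2 * n) * (1 - b * x t ^ (2 * n))))) (at t)" for t
    unfolding g_def
    by (auto intro!: derivative_eq_intros DERIV_chain2[OF hill_potential_derivative[OF R0]]
        x_deriv y_deriv z_deriv)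
  have "(g has_real_derivative 0) (at t)" if "u < t" "t < v" for t
    using der[of t] energy[of t] assms(2)[OF that]
    by (simp add: slope_eq_abs_p power2_eq_square algebra_simps)
  moreover have "continuous_on {u..v} g"
    by (intro continuous_at_imp_continuous_on ballI DERIV_isCont[OF der])
  ultimately have "g v = g u"
    using assms(1) False DERIV_isconst_end[of u v g] by simp
  then show ?thesis by (simp add: g_def algebra_simps)
qed simp

text \<open>
  The calibration estimate for the motion itself, at an arbitrary height \<open>R\<close> and for both
  directions \<open>\<epsilon> = \<plusminus>1\<close>; it handles the pieces of the geodesic by which a competitor is lengthened.
\<close>

lemma potential_difference_le:
  assumes "R > 0" "u \<le> v" and bd: "\<And>t. u \<le> t \<Longrightarrow> t \<le> v \<Longrightarrow> x t \<le> R" and "\<bar>\<epsilon>\<bar> = 1"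
  shows "\<epsilon> * (hill_potential n R (x v) - hill_potential n R (x u))
    \<le> v - u - (y v - y u) + 2 / R ^ (2 * n) * (z v - z u)"
proof -
  define g where "g t = t - y t + 2 / R ^ (2 * n) * z t - \<epsilon> * hill_potential n R (x t)" for t
  have "g u \<le> g v"
  proof (rule DERIV_nonneg_imp_nondecreasing[OF assms(2)])
    fix t assume t: "u \<le> t" "t \<le> v"
    let ?f = "1 - b * x t ^ (2 * n)" and ?F = "1 - 2 / R ^ (2 * n) * x t ^ (2 * n)"
    let ?S = "\<epsilon> * hill_slope n (x t / R)"
    have "(g has_real_derivative 1 - ?f + 2 / R ^ (2 * n) * (x t ^ (2 * n) * ?f)
        - \<epsilon> * (hill_slope n (x t / R) * p t)) (at t)"
      unfolding g_def
      by (intro DERIV_add DERIV_diff DERIV_ident DERIV_cmult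
        DERIV_chain2[OF hill_potential_derivative[OF assms(1)]] x_deriv y_deriv z_deriv)
    also have "1 - ?f + 2 / R ^ (2 * n) * (x t ^ (2 * n) * ?f) - \<epsilon> * (hill_slope n (x t / R) * p t)
      = 1 - (?S * p t + ?F * ?f)"
    proof -
      have "1 - f + l * (w * f) - \<epsilon> * (h * q) = 1 - (\<epsilon> * h * q + (1 - l * w) * f)"
        for f l w h q :: real by (simp add: algebra_simps)
      then show ?thesis .
    qed
    finally have "(g has_real_derivative 1 - (?S * p t + ?F * ?f)) (at t)" .
    moreover have "?S * p t + ?F * ?f \<le> sqrt ((p t)\<^sup>2 + ?f\<^sup>2)"
    proof (rule inner_le_norm_of_unit)
      have "\<epsilon>\<^sup>2 = 1" using \<open>\<bar>\<epsilon>\<bar> = 1\<close> by (metis power2_abs power_one)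
      then show "?S\<^sup>2 + ?F\<^sup>2 \<le> 1"
        using hill_potential_eikonal[OF n \<open>R > 0\<close>, of "x t"] x_nonneg[of t] bd[OF t]
        by (simp add: power_mult_distrib)
    qed
    ultimately show "\<exists>D. (g has_real_derivative D) (at t) \<and> 0 \<le> D"
      using energy[of t] by (intro exI[of _ "1 - (?S * p t + ?F * ?f)"]) simp
  qed
  then show ?thesis unfolding g_def right_diff_distrib by linarith
qed

lemma y_increase_le:
  assumes "u \<le> v"
  shows "y v - y u \<le> v - u"
proof -
  have "u - y u \<le> v - y v"
  proof (rule DERIV_nonneg_imp_nondecreasing[OF assms])
    fix t
    have "((\<lambda>t. t - y t) has_real_derivative 1 - (1 - b * x t ^ (2 * n))) (at t)"
      by (intro derivative_intros y_deriv)
    then show "\<exists>D. ((\<lambda>t. t - y t) has_real_derivative D) (at t) \<and> 0 \<le> D"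
      using b_pos x_nonneg[of t] by (intro exI[of _ "1 - (1 - b * x t ^ (2 * n))"]) simp
  qed
  then show ?thesis by simp
qed

text \<open>
  Here \<open>L\<close> is the length of a competitor of height \<open>R\<close>, bounded below by calibration at that
  height; the tails of the geodesic outside \<open>[u, v]\<close> must stay at or below \<open>R\<close>, so that the same
  potential applies to them. On \<open>[-s, s]\<close> all end point terms are collected in \<open>err s\<close>, which
  tends to 0. Apart from it, the virial identity expresses the duration of the geodesic by
  \<open>A = -b\<Delta>z\<close> alone, and what remains of \<open>L - (v - u)\<close> is \<open>A\<close> times
  \<open>M = 2n r + r\<^bsup>-2n\<^esup> - (2n + 1) \<ge> 0\<close>, where \<open>r = R/R\<^sub>0\<close>.
\<close>

lemma travel_time_le_of_dominating:
  assumes "u \<le> v" "R > 0" and tails: "\<And>t. t \<le> u \<or> v \<le> t \<Longrightarrow> x t \<le> R"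
    and L: "2 * hill_potential n R R - hill_potential n R (x u) - hill_potential n R (x v)
      \<le> L - (y v - y u) + 2 / R ^ (2 * n) * (z v - z u)"
  shows "v - u \<le> L"
proof -
  obtain T where T: "x T = R0" "\<And>t. t < T \<Longrightarrow> p t > 0" "\<And>t. T < t \<Longrightarrow> p t < 0"
    using turning_time by blast
  define \<kappa> where "\<kappa> = hill_action n 1"
  define r where "r = R / R0"
  define M where "M = 2 * real n * r + 1 / r ^ (2 * n) - (2 * real n + 1)"
  have "r > 0" using R0 \<open>R > 0\<close> by (simp add: r_def)
  have "M \<ge> 0" using mean_inequality_scaling[OF \<open>r > 0\<close>, of n] by (simp add: M_def)
  have \<kappa>: "hill_potential n R R = r * (R0 * \<kappa>)" "hill_potential n R0 R0 = R0 * \<kappa>"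
    using R0 \<open>R > 0\<close> by (auto simp: hill_potential_def r_def \<kappa>_def)
  have \<lambda>: "2 / R ^ (2 * n) = b / r ^ (2 * n)"
    using R0 \<open>R > 0\<close> by (simp add: b r_def power_divide)
  define err where "err s = (M + \<bar>r - 1\<bar>) * (x s + x (- s))
    + hill_potential n R (x s) + hill_potential n R (x (- s))" for s
  have bound: "v - u - err s \<le> L" if s: "s \<ge> \<bar>u\<bar>" "s \<ge> \<bar>v\<bar>" "s \<ge> \<bar>T\<bar>" for s
  proof -
    have range: "- s \<le> T" "T \<le> s" "- s \<le> u" "v \<le> s" "- s \<le> s" using s by auto
    define Y where "Y = y s - y (- s)"
    define A where "A = - (b * (z s - z (- s)))"
    define e where "e = x s * p s - x (- s) * p (- s)"
    have time: "2 * s - Y = e + (2 * real n + 1) * A"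
      using virial[of s "- s"] by (simp add: Y_def A_def e_def algebra_simps)
    have "2 * s - Y - A = 2 * (R0 * \<kappa>) - hill_potential n R0 (x s) - hill_potential n R0 (x (- s))"
    proof -
      have "T - (- s) - (y T - y (- s)) + b * (z T - z (- s)) =
          hill_potential n R0 (x T) - hill_potential n R0 (x (- s))"
        by (rule action_rising) (use range in simp, use T(2) in force)
      moreover have "s - T - (y s - y T) + b * (z s - z T) =
          hill_potential n R0 (x T) - hill_potential n R0 (x s)"
        by (rule action_falling) (use range in simp, use T(3) in force)
      ultimately show ?thesis
        by (simp add: Y_def A_def T(1) \<kappa> algebra_simps)
    qed
    then have kappa: "e + 2 * real n * A \<le> 2 * (R0 * \<kappa>)"
      using time hill_potential_nonneg[OF R0 x_nonneg, of n s]
        hill_potential_nonneg[OF R0 x_nonneg, of n "- s"] by (simp add: algebra_simps)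
    have e_le: "\<bar>e\<bar> \<le> x s + x (- s)"
    proof -
      have "\<bar>x t * p t\<bar> \<le> x t" for t
        using mult_left_le[OF abs_p_le_1[of t] x_nonneg[of t]] x_nonneg[of t] by (simp add: abs_mult)
      from this[of s] this[of "- s"] show ?thesis unfolding e_def by linarith
    qed
    \<comment> \<open>\<open>2s - Y \<ge> 0\<close> because \<open>y\<close> grows at most at unit rate; by the virial identity \<open>A\<close> is then nonnegative up to the error \<open>e\<close>.\<close>
    have A_ge: "- \<bar>e\<bar> \<le> A"
    proof -
      have "0 \<le> e + (2 * real n + 1) * A"
        using y_increase_le[OF range(5)] unfolding time[symmetric] Y_def by linarith
      show ?thesis
      proof (cases "A \<ge> 0")
        case False
        then have "(2 * real n + 1) * A \<le> 1 * A"
          by (intro mult_right_mono_neg) auto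
        with \<open>0 \<le> e + (2 * real n + 1) * A\<close> show ?thesis by linarith
      qed simp
    qed
    have "hill_potential n R (x u) - hill_potential n R (x (- s)) \<le>
        u - (- s) - (y u - y (- s)) + 2 / R ^ (2 * n) * (z u - z (- s))"
      using potential_difference_le[OF \<open>R > 0\<close> range(3), of 1] tails by simp
    moreover have "hill_potential n R (x v) - hill_potential n R (x s) \<le>
        s - v - (y s - y v) + 2 / R ^ (2 * n) * (z s - z v)"
      using potential_difference_le[OF \<open>R > 0\<close> range(4), of "- 1"] tails by simp
    ultimately have "2 * hill_potential n R R - hill_potential n R (x s) - hill_potential n R (x (- s))
      \<le> L - (v - u) + 2 * s - Y + 2 / R ^ (2 * n) * (z s - z (- s))"
      using L unfolding Y_def right_diff_distrib by linarith
    then have lower: "2 * (r * (R0 * \<kappa>)) - hill_potential n R (x s) - hill_potential n R (x (- s))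
      \<le> L - (v - u) + (2 * s - Y) - A / r ^ (2 * n)"
      unfolding \<kappa> \<lambda> A_def by simp
    have cap: "r * (e + 2 * real n * A) \<le> 2 * (r * (R0 * \<kappa>))"
      using mult_left_mono[OF kappa, of r] \<open>r > 0\<close> by (simp add: algebra_simps)
    have "A * M + (r - 1) * e - hill_potential n R (x s) - hill_potential n R (x (- s))
      \<le> L - (v - u)"
    proof -
      define Q W V where "Q = r * (e + 2 * real n * A)" and "W = A / r ^ (2 * n)"
        and "V = (2 * real n + 1) * A"
      have "A * M + (r - 1) * e = Q + W - V - e"
        by (simp add: M_def Q_def W_def V_def algebra_simps)
      with lower[folded W_def] cap[folded Q_def] time[folded V_def] show ?thesis
        by linarith
    qed
    moreover have "A * M \<ge> - (M * (x s + x (- s)))"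
      using mult_right_mono[of "- (x s + x (- s))" A M] A_ge e_le \<open>M \<ge> 0\<close> by (simp add: algebra_simps)
    moreover have "(r - 1) * e \<ge> - (\<bar>r - 1\<bar> * (x s + x (- s)))"
    proof -
      have "\<bar>(r - 1) * e\<bar> \<le> \<bar>r - 1\<bar> * (x s + x (- s))"
        unfolding abs_mult using e_le by (intro mult_left_mono) auto
      then show ?thesis by linarith
    qed
    ultimately show ?thesis by (simp add: err_def algebra_simps)
  qed
  have "((\<lambda>s. x (- s)) \<longlongrightarrow> 0) at_top"
    using x_bot by (simp add: filterlim_at_bot_mirror)
  then have "(err \<longlongrightarrow> (M + \<bar>r - 1\<bar>) * (0 + 0) + 0 + 0) at_top"
    unfolding err_def using x_top
    by (intro tendsto_intros hill_potential_tendsto_0 \<open>R > 0\<close>)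
  then have "((\<lambda>s. v - u - err s) \<longlongrightarrow> v - u - 0) at_top"
    by (intro tendsto_diff tendsto_const) simp
  then have "v - u - 0 \<le> L"
  proof (rule tendsto_upperbound)
    show "eventually (\<lambda>s. v - u - err s \<le> L) at_top"
      using eventually_ge_at_top[of "\<bar>u\<bar>"] eventually_ge_at_top[of "\<bar>v\<bar>"]
        eventually_ge_at_top[of "\<bar>T\<bar>"]
      by eventually_elim (rule bound)
  qed simp
  then show ?thesis by simp
qed

end

section \<open>Comparison with a horizontal curve\<close>

text \<open>
  The calibration at height \<open>R\<close>: \<open>\<beta>\<close> is chosen to make \<open>\<sigma> + \<beta>x\<^bsup>2n\<^esup>/(2n)!\<close> equal to
  \<open>\<sigma>(1 - 2(x/R)\<^bsup>2n\<^esup>)\<close>. The sign \<open>\<epsilon>\<close> chooses between climbing and descending.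
\<close>

lemma hill_calibration:
  assumes hor: "horizontal_curve k a b c" and int: "curve_speed c integrable_on {a..b}"
    and uv: "a \<le> u" "u \<le> v" "v \<le> b" and "n \<ge> 1" "2 * n \<le> k" and "R > 0"
    and bd: "\<And>t. t \<in> {u..v} \<Longrightarrow> \<bar>fst (c t)\<bar> \<le> R"
    and "\<bar>\<epsilon>\<bar> = 1" "\<bar>\<sigma>\<bar> = 1"
  shows "\<epsilon> * (hill_potential n R (fst (c v)) - hill_potential n R (fst (c u)))
      + \<sigma> * (snd (c v) 0 - snd (c u) 0)
      - 2 / R ^ (2 * n) * (\<sigma> * fact (2 * n) * (snd (c v) (2 * n) - snd (c u) (2 * n)))
    \<le> integral {u..v} (curve_speed c)"
proof -
  have sq: "\<epsilon>\<^sup>2 = 1" "\<sigma>\<^sup>2 = 1"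
    using \<open>\<bar>\<epsilon>\<bar> = 1\<close> \<open>\<bar>\<sigma>\<bar> = 1\<close> by (metis power2_abs power_one)+
  let ?\<beta> = "- (2 / R ^ (2 * n) * (\<sigma> * fact (2 * n)))"
  have "\<epsilon> * hill_potential n R (fst (c v)) - \<epsilon> * hill_potential n R (fst (c u))
      + \<sigma> * (snd (c v) 0 - snd (c u) 0) + ?\<beta> * (snd (c v) (2 * n) - snd (c u) (2 * n))
    \<le> integral {u..v} (curve_speed c)"
  proof (rule calibration_le_length[OF hor int uv \<open>2 * n \<le> k\<close>,
        where S = "\<lambda>s. \<epsilon> * hill_potential n R s" and S' = "\<lambda>s. \<epsilon> * hill_slope n (s / R)" and C = 1])
    show "((\<lambda>s. \<epsilon> * hill_potential n R s) has_real_derivative \<epsilon> * hill_slope n (s / R)) (at s)" for s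
      by (intro DERIV_cmult hill_potential_derivative \<open>R > 0\<close>)
    show "\<bar>\<epsilon> * hill_slope n (s / R)\<bar> \<le> 1" for s
      using abs_hill_slope_le_1[OF \<open>n \<ge> 1\<close>, of "s / R"] \<open>\<bar>\<epsilon>\<bar> = 1\<close> by (simp add: abs_mult)
    fix t assume "t \<in> {u..v}"
    have "\<sigma> + ?\<beta> * fst (c t) ^ (2 * n) / fact (2 * n) = \<sigma> * (1 - 2 / R ^ (2 * n) * fst (c t) ^ (2 * n))"
      by (simp add: algebra_simps)
    then show "(\<epsilon> * hill_slope n (fst (c t) / R))\<^sup>2
        + (\<sigma> + ?\<beta> * fst (c t) ^ (2 * n) / fact (2 * n))\<^sup>2 \<le> 1"
      using hill_potential_eikonal[OF \<open>n \<ge> 1\<close> \<open>R > 0\<close> bd[OF \<open>t \<in> {u..v}\<close>]]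
      by (simp add: power_mult_distrib sq)
  qed
  moreover have "?\<beta> * d = - (2 / R ^ (2 * n) * (\<sigma> * fact (2 * n) * d))" for d
    by (simp only: mult_minus_left mult.assoc)
  ultimately show ?thesis
    unfolding right_diff_distrib[of \<epsilon>] by simp
qed

context homoclinic_motion
begin

text \<open>
  Let \<open>R\<close> be the maximal height of the competitor. If the geodesic outside \<open>[u, v]\<close> stays below
  \<open>R\<close>, the competitor is calibrated up to its highest point and down again at height \<open>R\<close>, and
  \<open>travel_time_le_of_dominating\<close> applies. Otherwise \<open>R < R\<^sub>0\<close>, and the turning time lies outside
  \<open>[u, v]\<close>, because the heights outside an interval containing it are at most those of the end
  points. The geodesic is then monotone on \<open>[u, v]\<close>, and the calibration at height \<open>R\<^sub>0\<close> alone is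
  sharp.
\<close>

lemma horizontal_curve_length_ge:
  assumes hor: "horizontal_curve k a e c" and "a \<le> e" and "2 * n \<le> k" and "\<bar>\<sigma>\<bar> = 1" and "u \<le> v"
    and x_ends: "fst (c a) = x u" "fst (c e) = x v"
    and y_ends: "\<sigma> * (snd (c e) 0 - snd (c a) 0) = y v - y u"
    and z_ends: "\<sigma> * fact (2 * n) * (snd (c e) (2 * n) - snd (c a) (2 * n)) = z v - z u"
  shows "ennreal (v - u) \<le> sr_length a e c"
proof (cases "sr_length a e c < \<infinity>")
  case True
  note int = sr_length_eq_integral(1)[OF hor \<open>a \<le> e\<close> True]
  have "continuous_on {a..e} (\<lambda>t. \<bar>fst (c t)\<bar>)"
    using hor by (intro continuous_intros abs_continuous_on_imp_continuous_on)
      (simp add: horizontal_curve_def)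
  then obtain m where m: "m \<in> {a..e}" "\<And>t. t \<in> {a..e} \<Longrightarrow> \<bar>fst (c t)\<bar> \<le> \<bar>fst (c m)\<bar>"
    using continuous_attains_sup[of "{a..e}" "\<lambda>t. \<bar>fst (c t)\<bar>"] \<open>a \<le> e\<close> by auto
  define R where "R = \<bar>fst (c m)\<bar>"
  have ends_le: "x u \<le> R" "x v \<le> R"
    using m(2)[of a] m(2)[of e] \<open>a \<le> e\<close> x_nonneg by (auto simp: R_def x_ends)
  with x_pos[of u] have "R > 0" by linarith
  obtain T where T: "x T = R0" "\<And>t. t < T \<Longrightarrow> p t > 0" "\<And>t. T < t \<Longrightarrow> p t < 0"
    using turning_time by blast
  have "v - u \<le> integral {a..e} (curve_speed c)"
  proof (cases "\<forall>t. t \<le> u \<or> v \<le> t \<longrightarrow> x t \<le> R")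
    case True
    define l where "l = 2 / R ^ (2 * n)"
    define dy dz where "dy s t = \<sigma> * (snd (c t) 0 - snd (c s) 0)"
      and "dz s t = \<sigma> * fact (2 * n) * (snd (c t) (2 * n) - snd (c s) (2 * n))" for s t
    have top: "hill_potential n R (fst (c m)) = hill_potential n R R"
      by (metis R_def hill_potential_abs)
    have "hill_potential n R R - hill_potential n R (x u) + dy a m - l * dz a m
      \<le> integral {a..m} (curve_speed c)"
      using hill_calibration[OF hor int _ _ _ n \<open>2 * n \<le> k\<close> \<open>R > 0\<close>, of a m 1 \<sigma>] m \<open>\<bar>\<sigma>\<bar> = 1\<close>
      unfolding l_def dy_def dz_def top x_ends R_def[symmetric] by simp
    moreover have "hill_potential n R R - hill_potential n R (x v) + dy m e - l * dz m e
      \<le> integral {m..e} (curve_speed c)"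
      using hill_calibration[OF hor int _ _ _ n \<open>2 * n \<le> k\<close> \<open>R > 0\<close>, of m e "- 1" \<sigma>] m \<open>\<bar>\<sigma>\<bar> = 1\<close>
      unfolding l_def dy_def dz_def top x_ends R_def[symmetric] by simp
    moreover have "integral {a..m} (curve_speed c) + integral {m..e} (curve_speed c)
        = integral {a..e} (curve_speed c)"
      using m(1) int by (intro Henstock_Kurzweil_Integration.integral_combine) auto
    moreover have "dy a m + dy m e = y v - y u"
      unfolding dy_def y_ends[symmetric] by (simp add: algebra_simps)
    moreover have "dz a m + dz m e = z v - z u"
      unfolding dz_def z_ends[symmetric] by (simp add: algebra_simps)
    then have "l * dz a m + l * dz m e = l * (z v - z u)"
      by (simp flip: distrib_left)
    ultimately have "2 * hill_potential n R R - hill_potential n R (x u) - hill_potential n R (x v)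
      \<le> integral {a..e} (curve_speed c) - (y v - y u) + l * (z v - z u)"
      by linarith
    then show ?thesis
      unfolding l_def
      by (rule travel_time_le_of_dominating[OF \<open>u \<le> v\<close> \<open>R > 0\<close>, rotated]) (use True in blast)
  next
    case False
    then obtain w where w: "w \<le> u \<or> v \<le> w" "R < x w" by (auto simp: not_le)
    have "R \<le> R0" using w(2) x_le[of w] by simp
    have calibrate: "\<epsilon> * (hill_potential n R0 (x v) - hill_potential n R0 (x u))
        + (y v - y u) - b * (z v - z u) \<le> integral {a..e} (curve_speed c)" if "\<bar>\<epsilon>\<bar> = 1" for \<epsilon>
      using hill_calibration[OF hor int order_refl \<open>a \<le> e\<close> order_refl n \<open>2 * n \<le> k\<close> R0, of \<epsilon> \<sigma>]
        m(2) \<open>R \<le> R0\<close> that \<open>\<bar>\<sigma>\<bar> = 1\<close>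
      unfolding x_ends y_ends z_ends b R_def by fastforce
    consider "v \<le> T" | "T \<le> u" | "u < T" "T < v" by linarith
    then show ?thesis
    proof cases
      case 1
      have "v - u - (y v - y u) + b * (z v - z u) = hill_potential n R0 (x v) - hill_potential n R0 (x u)"
      proof (rule action_rising[OF \<open>u \<le> v\<close>])
        show "0 \<le> p t" if "t < v" for t using T(2)[of t] 1 that by simp
      qed
      with calibrate[of 1] show ?thesis by simp
    next
      case 2
      have "v - u - (y v - y u) + b * (z v - z u) = hill_potential n R0 (x u) - hill_potential n R0 (x v)"
      proof (rule action_falling[OF \<open>u \<le> v\<close>])
        show "p t \<le> 0" if "u < t" for t using T(3)[of t] 2 that by simp
      qed
      with calibrate[of "- 1"] show ?thesis by simp
    next
      case 3
      have "x w \<le> R"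
      proof (cases "w \<le> u")
        case True
        then have "x w \<le> x u"
        proof (rule DERIV_nonneg_imp_nondecreasing)
          fix t assume "w \<le> t" "t \<le> u"
          then show "\<exists>D. (x has_real_derivative D) (at t) \<and> 0 \<le> D"
            using x_deriv[of t] T(2)[of t] 3 by (intro exI[of _ "p t"]) simp
        qed
        then show ?thesis using ends_le by simp
      next
        case False
        then have "v \<le> w" using w by simp
        then have "x w \<le> x v"
        proof (rule DERIV_nonpos_imp_nonincreasing)
          fix t assume "v \<le> t" "t \<le> w"
          then show "\<exists>D. (x has_real_derivative D) (at t) \<and> D \<le> 0"
            using x_deriv[of t] T(3)[of t] 3 by (intro exI[of _ "p t"]) simp
        qed
        then show ?thesis using ends_le by simp
      qed
      with w show ?thesis by simp
    qed
  qed
  then show ?thesis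
    unfolding sr_length_eq_integral(2)[OF hor \<open>a \<le> e\<close> True] by (rule ennreal_leI)
next
  case False
  then show ?thesis by (simp add: not_less top_unique)
qed

end

section \<open>Geodesics of the jet space\<close>

text \<open>
  The limit of a homoclinic orbit is an equilibrium, where \<open>p = 0\<close> and \<open>x\<^bsup>2n-1\<^esup> f(x) = 0\<close>. The
  energy passes to the limit and gives \<open>f(x)\<^sup>2 = 1\<close> there, so the limit point is \<open>x = 0\<close> and not a
  zero of \<open>f\<close>.
\<close>

lemma homoclinic_motion_of_geodesic:
  assumes "n \<ge> 1" and "b > 0" and "2 * n \<le> k" and "\<bar>\<sigma>\<bar> = 1"
    and F: "\<And>s. poly F s = \<sigma> * (1 - b * s ^ (2 * n))"
    and geo: "homoclinic_geodesic k F {0..root (2 * n) (2 / b)} \<gamma>"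
  shows "homoclinic_motion n b (root (2 * n) (2 / b)) (\<lambda>t. fst (\<gamma> t)) (deriv (\<lambda>t. fst (\<gamma> t)))
    (\<lambda>t. \<sigma> * snd (\<gamma> t) 0) (\<lambda>t. \<sigma> * fact (2 * n) * snd (\<gamma> t) (2 * n))"
proof -
  define x where "x = (\<lambda>t. fst (\<gamma> t))"
  define p where "p = deriv x"
  define R0 where "R0 = root (2 * n) (2 / b)"
  define f where "f s = 1 - b * s ^ (2 * n)" for s
  have "\<sigma>\<^sup>2 = 1" using \<open>\<bar>\<sigma>\<bar> = 1\<close> by (metis power2_abs power_one)
  have H: "hamiltonian F = (\<lambda>q s. (q\<^sup>2 + (f s)\<^sup>2) / 2)"
    by (simp add: fun_eq_iff hamiltonian_def F f_def power_mult_distrib \<open>\<sigma>\<^sup>2 = 1\<close>)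
  have dp: "deriv (\<lambda>q. hamiltonian F q s) q = q" for q s
    unfolding H by (rule DERIV_imp_deriv) (auto intro!: derivative_eq_intros)
  have dx: "- deriv (\<lambda>s. hamiltonian F q s) s = 2 * real n * b * s ^ (2 * n - 1) * f s" for q s
  proof -
    have "(f has_real_derivative - (b * (real (2 * n) * s ^ (2 * n - 1)))) (at s)"
      unfolding f_def by (auto intro!: derivative_eq_intros)
    then have "((\<lambda>s. hamiltonian F q s) has_real_derivative
        f s * - (b * (real (2 * n) * s ^ (2 * n - 1)))) (at s)"
      unfolding H by (auto intro!: derivative_eq_intros)
    from DERIV_imp_deriv[OF this] show ?thesis by (simp add: algebra_simps)
  qed
  have sol: "hamiltonian_solution (hamiltonian F) p x"
    and energy: "\<And>t. hamiltonian F (p t) (x t) = 1 / 2"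
    and range: "\<And>t. x t \<in> {0..R0}"
    and vel: "\<And>t. has_velocity k \<gamma>
               (lin_comb (p t) (X_field (\<gamma> t)) (poly F (x t)) (Y_field k (\<gamma> t))) t"
    using geo by (auto simp: homoclinic_geodesic_def jet_geodesic_def Let_def x_def p_def R0_def)
  have orbit: "homoclinic_orbit (hamiltonian F) p x"
    using geo by (simp add: homoclinic_geodesic_def x_def p_def)
  have en: "(p t)\<^sup>2 + (f (x t))\<^sup>2 = 1" for t
    using energy[of t] by (simp add: H)
  have theta: "((\<lambda>s. snd (\<gamma> s) i) has_real_derivative \<sigma> * f (x t) * (x t ^ i / fact i)) (at t)"
    if "i \<le> k" for i t
    using vel[of t] that
    by (simp add: has_velocity_def lin_comb_def X_field_def Y_field_def F f_def x_def)
  obtain p0 x0 where eq: "hamiltonian_solution (hamiltonian F) (\<lambda>_. p0) (\<lambda>_. x0)"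
    and top: "((\<lambda>t. (p t, x t)) \<longlongrightarrow> (p0, x0)) at_top"
    and bot: "((\<lambda>t. (p t, x t)) \<longlongrightarrow> (p0, x0)) at_bot"
    using orbit by (auto simp: homoclinic_orbit_def)
  have "((\<lambda>_. x0) has_real_derivative p0) (at 0)"
    using eq by (simp add: hamiltonian_solution_def dp)
  then have "p0 = 0" using DERIV_const by (rule DERIV_unique)
  have "((\<lambda>_. p0) has_real_derivative 2 * real n * b * x0 ^ (2 * n - 1) * f x0) (at 0)"
    using eq unfolding hamiltonian_solution_def dx by blast
  then have crit: "2 * real n * b * x0 ^ (2 * n - 1) * f x0 = 0"
    using DERIV_const by (rule DERIV_unique)
  have x_top: "(x \<longlongrightarrow> x0) at_top" and x_bot: "(x \<longlongrightarrow> x0) at_bot" and p_top: "(p \<longlongrightarrow> p0) at_top"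
    using tendsto_snd[OF top] tendsto_snd[OF bot] tendsto_fst[OF top] by simp_all
  have "((\<lambda>t. (p t)\<^sup>2 + (f (x t))\<^sup>2) \<longlongrightarrow> p0\<^sup>2 + (f x0)\<^sup>2) at_top"
    unfolding f_def by (intro tendsto_intros x_top p_top)
  then have "p0\<^sup>2 + (f x0)\<^sup>2 = 1"
    unfolding en by (simp add: tendsto_const_iff)
  then have "f x0 \<noteq> 0" using \<open>p0 = 0\<close> by auto
  with crit have "x0 = 0" using \<open>n \<ge> 1\<close> \<open>b > 0\<close> by simp
  show ?thesis
    unfolding x_def[symmetric] p_def[symmetric] R0_def[symmetric]
  proof
    show "n \<ge> 1" by fact
    show "R0 > 0" using \<open>n \<ge> 1\<close> \<open>b > 0\<close> by (simp add: R0_def)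
    show "b = 2 / R0 ^ (2 * n)" using \<open>n \<ge> 1\<close> \<open>b > 0\<close> by (simp add: R0_def)
    show "(x has_real_derivative p t) (at t)" for t
      using sol by (simp add: hamiltonian_solution_def dp)
    show "(p has_real_derivative 2 * real n * b * x t ^ (2 * n - 1) * (1 - b * x t ^ (2 * n))) (at t)" for t
      using sol by (simp add: hamiltonian_solution_def dx f_def)
    show "((\<lambda>t. \<sigma> * snd (\<gamma> t) 0) has_real_derivative 1 - b * x t ^ (2 * n)) (at t)" for t
    proof -
      have "\<sigma> * (\<sigma> * f (x t) * (x t ^ 0 / fact 0)) = \<sigma>\<^sup>2 * f (x t)"
        by (simp add: power2_eq_square)
      also have "\<dots> = 1 - b * x t ^ (2 * n)" by (simp add: \<open>\<sigma>\<^sup>2 = 1\<close> f_def)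
      finally show ?thesis using DERIV_cmult[OF theta[of 0 t], of \<sigma>] by (simp only: le0 simp_thms)
    qed
    show "((\<lambda>t. \<sigma> * fact (2 * n) * snd (\<gamma> t) (2 * n)) has_real_derivative
        x t ^ (2 * n) * (1 - b * x t ^ (2 * n))) (at t)" for t
    proof -
      have "\<sigma> * fact (2 * n) * (\<sigma> * f (x t) * (x t ^ (2 * n) / fact (2 * n)))
          = \<sigma>\<^sup>2 * (x t ^ (2 * n) * f (x t))"
        by (simp add: power2_eq_square)
      also have "\<dots> = x t ^ (2 * n) * (1 - b * x t ^ (2 * n))" by (simp add: \<open>\<sigma>\<^sup>2 = 1\<close> f_def)
      finally show ?thesis
        using DERIV_cmult[OF theta[OF \<open>2 * n \<le> k\<close>, of t], of "\<sigma> * fact (2 * n)"] by (simp only:)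
    qed
    show "(p t)\<^sup>2 + (1 - b * x t ^ (2 * n))\<^sup>2 = 1" for t
      using en[of t] by (simp add: f_def)
    show "0 \<le> x t" "x t \<le> R0" for t using range[of t] by auto
    show "\<exists>t. x t \<noteq> 0"
    proof (rule ccontr)
      assume "\<not> (\<exists>t. x t \<noteq> 0)"
      then have "x = (\<lambda>_. 0)" by auto
      then have "p = (\<lambda>_. 0)" unfolding p_def by (metis DERIV_const DERIV_imp_deriv)
      with \<open>x = (\<lambda>_. 0)\<close> orbit show False by (simp add: homoclinic_orbit_def)
    qed
    show "(x \<longlongrightarrow> 0) at_top" "(x \<longlongrightarrow> 0) at_bot"
      using x_top x_bot \<open>x0 = 0\<close> by simp_all
  qed
qed

text \<open>
  The compact hill interval bounds all the coordinate velocities, so the geodesic is Lipschitz in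
  each coordinate.
\<close>

lemma jet_geodesic_unit_speed:
  assumes "jet_geodesic k F {l..r} \<gamma>"
  shows "horizontal_curve k a e \<gamma>" and "a \<le> e \<Longrightarrow> sr_length a e \<gamma> = ennreal (e - a)"
proof -
  define x where "x = (\<lambda>t. fst (\<gamma> t))"
  define p where "p = deriv x"
  have range: "\<And>t. l \<le> x t \<and> x t \<le> r" and jet: "\<And>t. \<gamma> t \<in> jet_space k"
    and vel: "\<And>t. has_velocity k \<gamma>
               (lin_comb (p t) (X_field (\<gamma> t)) (poly F (x t)) (Y_field k (\<gamma> t))) t"
    and half: "\<And>t. hamiltonian F (p t) (x t) = 1 / 2"
    using assms by (auto simp: jet_geodesic_def Let_def x_def p_def)
  have energy: "(p t)\<^sup>2 + (poly F (x t))\<^sup>2 = 1" for t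
  proof -
    have "(p t)\<^sup>2 + (poly F (x t))\<^sup>2 = 2 * hamiltonian F (p t) (x t)"
      by (simp add: hamiltonian_def)
    then show ?thesis by (simp add: half)
  qed
  have x_deriv: "(x has_real_derivative p t) (at t)" for t
    using vel[of t] by (simp add: has_velocity_def lin_comb_def X_field_def Y_field_def x_def)
  have theta: "((\<lambda>s. snd (\<gamma> s) i) has_real_derivative poly F (x t) * (x t ^ i / fact i)) (at t)"
    if "i \<le> k" for i t
    using vel[of t] that
    by (simp add: has_velocity_def lin_comb_def X_field_def Y_field_def x_def)
  have p_le: "\<bar>p t\<bar> \<le> 1" and F_le: "\<bar>poly F (x t)\<bar> \<le> 1" for t
  proof -
    have "(p t)\<^sup>2 \<le> 1" "(poly F (x t))\<^sup>2 \<le> 1"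
      unfolding energy[of t, symmetric] by simp_all
    then show "\<bar>p t\<bar> \<le> 1" "\<bar>poly F (x t)\<bar> \<le> 1" by (simp_all add: abs_square_le_1)
  qed
  define M where "M = \<bar>l\<bar> + \<bar>r\<bar>"
  have x_le: "\<bar>x t\<bar> \<le> M" for t using range[of t] by (auto simp: M_def)
  have ac_x: "abs_continuous_on a e (\<lambda>t. fst (\<gamma> t))"
    using abs_continuous_on_bounded_derivative[OF x_deriv p_le] by (simp add: x_def)
  have ac_theta: "abs_continuous_on a e (\<lambda>t. snd (\<gamma> t) i)" if "i \<le> k" for i
  proof (rule abs_continuous_on_bounded_derivative[OF theta[OF that]])
    fix t
    have "\<bar>poly F (x t) * (x t ^ i / fact i)\<bar> = \<bar>poly F (x t)\<bar> * (\<bar>x t\<bar> ^ i / fact i)"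
      by (simp add: abs_mult power_abs)
    also have "\<dots> \<le> 1 * (M ^ i / fact i)"
      using F_le x_le by (intro mult_mono divide_right_mono power_mono) auto
    finally show "\<bar>poly F (x t) * (x t ^ i / fact i)\<bar> \<le> M ^ i / fact i" by simp
  qed
  have "\<exists>u v. has_velocity k \<gamma> (lin_comb u (X_field (\<gamma> t)) v (Y_field k (\<gamma> t))) t" for t
    using vel by blast
  then show "horizontal_curve k a e \<gamma>"
    unfolding horizontal_curve_def using jet ac_x ac_theta by (auto intro!: AE_I2)
  have "deriv (\<lambda>s. fst (\<gamma> s)) t = p t" "deriv (\<lambda>s. snd (\<gamma> s) 0) t = poly F (x t)" for t
    using DERIV_imp_deriv[OF theta[of 0 t]] by (simp_all add: p_def x_def)
  then show "sr_length a e \<gamma> = ennreal (e - a)" if "a \<le> e"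
    using that by (simp add: sr_length_def energy)
qed

theorem theorem2:
  fixes n k :: nat and b :: real and F :: "real poly" and \<gamma> :: "real \<Rightarrow> jet"
  assumes "n \<ge> 1" and "b > 0" and "k \<ge> 2 * n"
    and "F = 1 - monom b (2 * n) \<or> F = - (1 - monom b (2 * n))"
    and "homoclinic_geodesic k F {0..root (2 * n) (2 / b)} \<gamma>"
  shows "metric_line k \<gamma>"
proof -
  obtain \<sigma> :: real where "\<bar>\<sigma>\<bar> = 1" and F: "\<And>s. poly F s = \<sigma> * (1 - b * s ^ (2 * n))"
  proof -
    from assms(4) show ?thesis
    proof
      assume "F = 1 - monom b (2 * n)"
      then show ?thesis by (intro that[of 1]) (auto simp: poly_monom)
    next
      assume "F = - (1 - monom b (2 * n))"
      then show ?thesis by (intro that[of "- 1"]) (auto simp: poly_monom)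
    qed
  qed
  interpret homoclinic_motion n b "root (2 * n) (2 / b)" "\<lambda>t. fst (\<gamma> t)" "deriv (\<lambda>t. fst (\<gamma> t))"
    "\<lambda>t. \<sigma> * snd (\<gamma> t) 0" "\<lambda>t. \<sigma> * fact (2 * n) * snd (\<gamma> t) (2 * n)"
    using homoclinic_motion_of_geodesic[OF assms(1-3) \<open>\<bar>\<sigma>\<bar> = 1\<close> F assms(5)] .
  have geo: "jet_geodesic k F {0..root (2 * n) (2 / b)} \<gamma>"
    using assms(5) by (simp add: homoclinic_geodesic_def)
  show ?thesis
    unfolding metric_line_def
  proof (intro allI impI antisym)
    fix u v :: real
    assume "u \<le> v"
    show "ennreal \<bar>u - v\<bar> \<le> sr_dist k (\<gamma> u) (\<gamma> v)"
      unfolding sr_dist_def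
    proof (rule Inf_greatest)
      fix d
      assume "d \<in> {sr_length a e c | a e c. a \<le> e \<and> horizontal_curve k a e c \<and> c a = \<gamma> u \<and> c e = \<gamma> v}"
      then obtain a e c where c: "d = sr_length a e c" "a \<le> e" "horizontal_curve k a e c"
          "c a = \<gamma> u" "c e = \<gamma> v"
        by blast
      have "ennreal (v - u) \<le> sr_length a e c"
        using c(4,5)
        by (intro horizontal_curve_length_ge[OF c(3,2) assms(3) \<open>\<bar>\<sigma>\<bar> = 1\<close> \<open>u \<le> v\<close>])
           (simp_all add: right_diff_distrib)
      then show "ennreal \<bar>u - v\<bar> \<le> d" using c(1) \<open>u \<le> v\<close> by (simp add: abs_minus_commute)
    qed
    have "sr_dist k (\<gamma> u) (\<gamma> v) \<le> sr_length u v \<gamma>"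
      unfolding sr_dist_def
      using jet_geodesic_unit_speed(1)[OF geo, of u v] \<open>u \<le> v\<close> by (intro Inf_lower) blast
    then show "sr_dist k (\<gamma> u) (\<gamma> v) \<le> ennreal \<bar>u - v\<bar>"
      using jet_geodesic_unit_speed(2)[OF geo \<open>u \<le> v\<close>] \<open>u \<le> v\<close> by (simp add: abs_minus_commute)
  qed
qed

end
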